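(* Let $L(\lambda)=\lambda M+K\in\mathbb{R}^{2n\times2n}[\lambda]$ be a regular real $T$-SHH pencil, let $0\le m_1\le m_2\le p$ be integers with $2m_1+2p<2n$, and let $X_c\in\mathbb{R}^{2n\times(2m_1+2p)}$ and $\Lambda_c,\Lambda_a\in\mathbb{R}^{(2m_1+2p)\times(2m_1+2p)}$ be the matrices built from eigenpairs of $L(\lambda)$ and from the aimed eigenvalues as described in the context. Let $(X_c,\Lambda_c)$ and $(X_f,\Lambda_f)$ be complementary deflating pairs of $L(\lambda)$. Suppose that (a) $\sigma(\Lambda_c)\cap\sigma(-\Lambda_f^T)=\emptyset$, (b) $G:=X_c^TJMX_c$ is nonsingular, and that all the eigenvalues to be changed (the eigenvalues of $\Lambda_c$) are distinct. Put $U:=JMX_cG^{-1}$, $H_a=(\Lambda_a^T\Lambda_a+I_{2m_1+2p})^{-1}$ and $$\hat M=G(\Lambda_c-\Lambda_a)H_a\Lambda_a^T+Z_1(I_{2m_1+2p}-\Lambda_aH_a\Lambda_a^T)-Z_2H_a\Lambda_a^T,$$ $$\hat K=G(\Lambda_c-\Lambda_a)H_a-Z_1\Lambda_aH_a+Z_2(I_{2m_1+2p}-H_a),$$ where $Z_i=\mathrm{diag}(Z_1^{(i)},\dots,Z_{m_1}^{(i)},Z_{m_1+1}^{(i)},\dots,Z_{m_2}^{(i)},Z_{m_2+1}^{(i)},\dots,Z_p^{(i)})$, $i=1,2$, with $$Z_j^{(1)}=\begin{bmatrix}\mathbf{0} & \alpha_jI_2+\beta_jJ_2 \\ -\alpha_jI_2+\beta_jJ_2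 & \mathbf{0}\end{bmatrix},\quad Z_j^{(2)}=\begin{bmatrix}\mathbf{0} & u_jI_2+v_jJ_2 \\ {u_j}I_2-v_jJ_2 & \mathbf{0}\end{bmatrix},$$ $$Z_k^{(1)}=\beta_kJ_2,\quad Z_k^{(2)}=u_kI_2,\quad Z_l^{(1)}=\beta_lJ_2,\quad Z_l^{(2)}=u_l\begin{bmatrix}0&1\\1&0\end{bmatrix},$$ where $J_2=\begin{bmatrix}0&1\\-1&0\end{bmatrix}$ and $\alpha_j,\beta_j,u_j,v_j,\beta_k,u_k,\beta_l,u_l$ are arbitrary real numbers $(j=1,\dots,m_1;\ k=m_1+1,\dots,m_2;\ l=m_2+1,\dots,p)$. Then $\Delta M=J^TU\hat MU^T$ is $T$-skew-Hamiltonian, $\Delta K=J^TU\hat KU^T$ is $T$-Hamiltonian, and $(X_c,\Lambda_a)$ and $(X_f,\Lambda_f)$ are complementary deflating pairs of $L_\Delta(\lambda)=\lambda(M+\Delta M)+(K+\Delta K)$.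
   Context: $J=\begin{bmatrix}0&I_n\\-I_n&0\end{bmatrix}$. A matrix $A\in\mathbb{C}^{2n\times2n}$ is $T$-skew-Hamiltonian if $(JA)^T=-JA$ and $T$-Hamiltonian if $(JA)^T=JA$; a pencil $\lambda M+K$ is $T$-SHH ($T$-skew-Hamiltonian/Hamiltonian) if $M$ is $T$-skew-Hamiltonian and $K$ is $T$-Hamiltonian. A pencil is regular if $\det(\lambda M+K)$ is not the zero polynomial. A deflating pair of a pencil $\lambda M+K\in\mathbb{C}^{N\times N}[\lambda]$ is a matrix pair $(X,\Lambda)\in\mathbb{C}^{N\times q}\times\mathbb{C}^{q\times q}$ with $\operatorname{rank}X=q\le N$ and $MX\Lambda+KX=0$. Two deflating pairs $(X_1,\Lambda_1)$, $(X_2,\Lambda_2)$ are complementary if $[X_1\ X_2]$ is a nonsingular square matrix. $\sigma(\Lambda)$ is the spectrum of $\Lambda$. Throughout, $j\in\{1,\dots,m_1\}$, $k\in\{m_1+1,\dots,m_2\}$, $l\in\{m_2+1,\dots,p\}$. Eigenvalues of $L(\lambda)$ to be changed: quadruples $(\lambda_j^c,\overline{\lambda_j^c},-\overline{\lambda_j^c},-\lambda_j^c)$ are to be replaced by $(\lambda_j^a,\overline{\lambda_j^a},-\overline{\lambda_j^a},-\lambda_j^a)$, where $\lambda_j^c,\lambda_j^a$ have nonzero real and nonzero imaginary parts; pairs $(\lambda_k^c,\overline{\lambda_k^c})$ are to be replaced by $(\lambda_k^a,\overline{\lambda_k^a})$, where $\lambda_k^c,\lambda_k^a$ have zero real parts;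 pairs $(\lambda_l^c,-\lambda_l^c)$ are to be replaced by $(\lambda_l^a,-\lambda_l^a)$, where $\lambda_l^c,\lambda_l^a$ have zero imaginary parts. Let $x_j^c,\hat x_j^c$ be eigenvectors for $\lambda_j^c,-\overline{\lambda_j^c}$; $x_k^c$ an eigenvector for $\lambda_k^c$; and $x_l^c,\hat x_l^c$ (real) eigenvectors for $\lambda_l^c,-\lambda_l^c$. Set $X_c=[X_1^c\ \cdots\ X_p^c]$ with $X_j^c=[\mathrm{re}(x_j^c)\ \mathrm{im}(x_j^c)\ \mathrm{re}(\hat x_j^c)\ \mathrm{im}(\hat x_j^c)]$, $X_k^c=[\mathrm{re}(x_k^c)\ \mathrm{im}(x_k^c)]$, $X_l^c=[x_l^c\ \hat x_l^c]$. For $s\in\{c,a\}$ set $\Lambda_s=\mathrm{diag}(\Lambda_1^s,\dots,\Lambda_p^s)$ with $$\Lambda_j^s=\mathrm{diag}(\hat\Lambda_j^s,-(\hat\Lambda_j^s)^T),\quad \hat\Lambda_j^s=\begin{bmatrix}\mathrm{re}(\lambda_j^s)&\mathrm{im}(\lambda_j^s)\\-\mathrm{im}(\lambda_j^s)&\mathrm{re}(\lambda_j^s)\end{bmatrix},\quad \Lambda_k^s=\begin{bmatrix}0&\mathrm{im}(\lambda_k^s)\\-\mathrm{im}(\lambda_k^s)&0\end{bmatrix},\quad \Lambda_l^s=\mathrm{diag}(\lambda_l^s,-\lambda_l^s).$$ *)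

theory Defs
  imports
    "Jordan_Normal_Form.Spectral_Radius"
    "Jordan_Normal_Form.DL_Rank"
begin

section \<open>T-skew-Hamiltonian/Hamiltonian pencils\<close>

text \<open>A pencil \<open>\<lambda>M + K\<close> is represented by its two coefficient matrices. The structure notions only
  involve ring operations, so they are stated over any commutative ring and used for real matrices.\<close>

definition J_mat :: "nat \<Rightarrow> 'a :: comm_ring_1 mat" where
  "J_mat n = four_block_mat (0\<^sub>m n n) (1\<^sub>m n) (- 1\<^sub>m n) (0\<^sub>m n n)"

definition T_skew_Hamiltonian :: "nat \<Rightarrow> 'a :: comm_ring_1 mat \<Rightarrow> bool" where
  "T_skew_Hamiltonian n A \<longleftrightarrow>
     A \<in> carrier_mat (2 * n) (2 * n) \<and> (J_mat n * A)\<^sup>T = - (J_mat n * A)"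

definition T_Hamiltonian :: "nat \<Rightarrow> 'a :: comm_ring_1 mat \<Rightarrow> bool" where
  "T_Hamiltonian n A \<longleftrightarrow>
     A \<in> carrier_mat (2 * n) (2 * n) \<and> (J_mat n * A)\<^sup>T = J_mat n * A"

definition T_SHH :: "nat \<Rightarrow> 'a :: comm_ring_1 mat \<Rightarrow> 'a mat \<Rightarrow> bool" where
  "T_SHH n M K \<longleftrightarrow> T_skew_Hamiltonian n M \<and> T_Hamiltonian n K"

definition pencil_poly_mat :: "'a :: comm_ring_1 mat \<Rightarrow> 'a mat \<Rightarrow> 'a poly mat" where
  "pencil_poly_mat M K = [:0, 1:] \<cdot>\<^sub>m map_mat (\<lambda>a. [:a:]) M + map_mat (\<lambda>a. [:a:]) K"

definition regular_pencil :: "'a :: comm_ring_1 mat \<Rightarrow> 'a mat \<Rightarrow> bool" where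
  "regular_pencil M K \<longleftrightarrow> det (pencil_poly_mat M K) \<noteq> 0"

definition pencil_eigenvector :: "nat \<Rightarrow> complex mat \<Rightarrow> complex mat \<Rightarrow> complex vec \<Rightarrow> complex \<Rightarrow> bool" where
  "pencil_eigenvector N M K x \<mu> \<longleftrightarrow>
     x \<in> carrier_vec N \<and> x \<noteq> 0\<^sub>v N \<and> (\<mu> \<cdot>\<^sub>m M + K) *\<^sub>v x = 0\<^sub>v N"

definition deflating_pair :: "nat \<Rightarrow> complex mat \<Rightarrow> complex mat \<Rightarrow> complex mat \<times> complex mat \<Rightarrow> bool" where
  "deflating_pair N M K = (\<lambda>(X, \<Lambda>). \<exists>q \<le> N.
     X \<in> carrier_mat N q \<and> \<Lambda> \<in> carrier_mat q q \<and> vec_space.rank N X = q \<and>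
     M * X * \<Lambda> + K * X = 0\<^sub>m N q)"

definition complementary_deflating_pairs ::
  "nat \<Rightarrow> complex mat \<Rightarrow> complex mat \<Rightarrow> complex mat \<times> complex mat \<Rightarrow> complex mat \<times> complex mat \<Rightarrow> bool" where
  "complementary_deflating_pairs N M K P\<^sub>1 P\<^sub>2 \<longleftrightarrow>
     deflating_pair N M K P\<^sub>1 \<and> deflating_pair N M K P\<^sub>2 \<and>
     invertible_mat (mat_of_cols N (cols (fst P\<^sub>1) @ cols (fst P\<^sub>2)))"

text \<open>The matrix inverse; meaningful for invertible matrices only.\<close>

definition inv_mat :: "'a :: field mat \<Rightarrow> 'a mat" where
  "inv_mat A = the (mat_inverse A)"

abbreviation cmat :: "real mat \<Rightarrow> complex mat" where
  "cmat \<equiv> map_mat complex_of_real"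


section \<open>The matrices built from eigenvalues, eigenvectors and free parameters\<close>

text \<open>The data are families indexed by \<open>{1..p}\<close>; the indices in \<open>{1..m\<^sub>1}\<close>, \<open>{m\<^sub>1+1..m\<^sub>2}\<close> and
  \<open>{m\<^sub>2+1..p}\<close> belong to eigenvalue quadruples, purely imaginary pairs and real pairs.\<close>

definition by_kind :: "nat \<Rightarrow> nat \<Rightarrow> (nat \<Rightarrow> 'b) \<Rightarrow> (nat \<Rightarrow> 'b) \<Rightarrow> (nat \<Rightarrow> 'b) \<Rightarrow> nat \<Rightarrow> 'b" where
  "by_kind m\<^sub>1 m\<^sub>2 f g h i = (if i \<le> m\<^sub>1 then f i else if i \<le> m\<^sub>2 then g i else h i)"

definition changed_eigenvalues :: "nat \<Rightarrow> nat \<Rightarrow> nat \<Rightarrow> (nat \<Rightarrow> complex) \<Rightarrow> complex list" where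
  "changed_eigenvalues m\<^sub>1 m\<^sub>2 p ev = concat (map (by_kind m\<^sub>1 m\<^sub>2
     (\<lambda>j. [ev j, cnj (ev j), - cnj (ev j), - ev j])
     (\<lambda>k. [ev k, cnj (ev k)])
     (\<lambda>l. [ev l, - ev l])) [1..<Suc p])"

text \<open>For the real eigenvectors of the third kind, \<open>map_vec Re\<close> is just the passage to a real vector.\<close>

definition X_mat :: "nat \<Rightarrow> nat \<Rightarrow> nat \<Rightarrow> nat \<Rightarrow> (nat \<Rightarrow> complex vec) \<Rightarrow> (nat \<Rightarrow> complex vec) \<Rightarrow> real mat" where
  "X_mat N m\<^sub>1 m\<^sub>2 p x xh = mat_of_cols N (concat (map (by_kind m\<^sub>1 m\<^sub>2
     (\<lambda>j. [map_vec Re (x j), map_vec Im (x j), map_vec Re (xh j), map_vec Im (xh j)])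
     (\<lambda>k. [map_vec Re (x k), map_vec Im (x k)])
     (\<lambda>l. [map_vec Re (x l), map_vec Re (xh l)])) [1..<Suc p]))"

definition mat2 :: "'a \<Rightarrow> 'a \<Rightarrow> 'a \<Rightarrow> 'a \<Rightarrow> 'a mat" where
  "mat2 a b c d = mat_of_rows_list 2 [[a, b], [c, d]]"

definition Lam_hat :: "complex \<Rightarrow> real mat" where
  "Lam_hat \<mu> = mat2 (Re \<mu>) (Im \<mu>) (- Im \<mu>) (Re \<mu>)"

definition Lam_mat :: "nat \<Rightarrow> nat \<Rightarrow> nat \<Rightarrow> (nat \<Rightarrow> complex) \<Rightarrow> real mat" where
  "Lam_mat m\<^sub>1 m\<^sub>2 p ev = diag_block_mat (map (by_kind m\<^sub>1 m\<^sub>2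
     (\<lambda>j. diag_block_mat [Lam_hat (ev j), - (Lam_hat (ev j))\<^sup>T])
     (\<lambda>k. mat2 0 (Im (ev k)) (- Im (ev k)) 0)
     (\<lambda>l. mat2 (Re (ev l)) 0 0 (- Re (ev l)))) [1..<Suc p])"

definition J2 :: "real mat" where
  "J2 = mat2 0 1 (- 1) 0"

definition Z1_mat :: "nat \<Rightarrow> nat \<Rightarrow> nat \<Rightarrow> (nat \<Rightarrow> real) \<Rightarrow> (nat \<Rightarrow> real) \<Rightarrow> real mat" where
  "Z1_mat m\<^sub>1 m\<^sub>2 p \<alpha> \<beta> = diag_block_mat (map (by_kind m\<^sub>1 m\<^sub>2
     (\<lambda>j. four_block_mat
        (0\<^sub>m 2 2) (\<alpha> j \<cdot>\<^sub>m 1\<^sub>m 2 + \<beta> j \<cdot>\<^sub>m J2)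
        ((- \<alpha> j) \<cdot>\<^sub>m 1\<^sub>m 2 + \<beta> j \<cdot>\<^sub>m J2) (0\<^sub>m 2 2))
     (\<lambda>k. \<beta> k \<cdot>\<^sub>m J2)
     (\<lambda>l. \<beta> l \<cdot>\<^sub>m J2)) [1..<Suc p])"

definition Z2_mat :: "nat \<Rightarrow> nat \<Rightarrow> nat \<Rightarrow> (nat \<Rightarrow> real) \<Rightarrow> (nat \<Rightarrow> real) \<Rightarrow> real mat" where
  "Z2_mat m\<^sub>1 m\<^sub>2 p u v = diag_block_mat (map (by_kind m\<^sub>1 m\<^sub>2
     (\<lambda>j. four_block_mat
        (0\<^sub>m 2 2) (u j \<cdot>\<^sub>m 1\<^sub>m 2 + v j \<cdot>\<^sub>m J2)
        (u j \<cdot>\<^sub>m 1\<^sub>m 2 - v j \<cdot>\<^sub>m J2) (0\<^sub>m 2 2))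
     (\<lambda>k. u k \<cdot>\<^sub>m 1\<^sub>m 2)
     (\<lambda>l. u l \<cdot>\<^sub>m mat2 0 1 1 0)) [1..<Suc p])"

text \<open>The third kind of eigenvectors is required to be real.\<close>

definition eigen_data ::
  "nat \<Rightarrow> real mat \<Rightarrow> real mat \<Rightarrow> nat \<Rightarrow> nat \<Rightarrow> nat \<Rightarrow> (nat \<Rightarrow> complex) \<Rightarrow>
   (nat \<Rightarrow> complex vec) \<Rightarrow> (nat \<Rightarrow> complex vec) \<Rightarrow> bool" where
  "eigen_data N M K m\<^sub>1 m\<^sub>2 p ev x xh \<longleftrightarrow>
     (\<forall>j\<in>{1..m\<^sub>1}. pencil_eigenvector N (cmat M) (cmat K) (x j) (ev j) \<and>
                  pencil_eigenvector N (cmat M) (cmat K) (xh j) (- cnj (ev j))) \<and>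
     (\<forall>k\<in>{m\<^sub>1+1..m\<^sub>2}. pencil_eigenvector N (cmat M) (cmat K) (x k) (ev k)) \<and>
     (\<forall>l\<in>{m\<^sub>2+1..p}. pencil_eigenvector N (cmat M) (cmat K) (x l) (ev l) \<and>
                  pencil_eigenvector N (cmat M) (cmat K) (xh l) (- ev l) \<and>
                  map_vec Im (x l) = 0\<^sub>v N \<and> map_vec Im (xh l) = 0\<^sub>v N)"

definition eigenvalue_kinds :: "nat \<Rightarrow> nat \<Rightarrow> nat \<Rightarrow> (nat \<Rightarrow> complex) \<Rightarrow> bool" where
  "eigenvalue_kinds m\<^sub>1 m\<^sub>2 p ev \<longleftrightarrow>
     (\<forall>j\<in>{1..m\<^sub>1}. Re (ev j) \<noteq> 0 \<and> Im (ev j) \<noteq> 0) \<and>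
     (\<forall>k\<in>{m\<^sub>1+1..m\<^sub>2}. Re (ev k) = 0) \<and>
     (\<forall>l\<in>{m\<^sub>2+1..p}. Im (ev l) = 0)"

end

theory Submission
  imports Defs
begin

text \<open>Multiplication by \<open>J\<close> turns the pencil into one with skew-symmetric \<open>S = J M\<close> and symmetric \<open>R = J K\<close>,
  where a deflating pair satisfies \<open>S X \<Lambda> = -R X\<close>. In these terms \<open>G = X\<^sub>c\<^sup>T S X\<^sub>c\<close> is skew-symmetric,
  \<open>G \<Lambda>\<^sub>c = -X\<^sub>c\<^sup>T R X\<^sub>c\<close> is symmetric, and the update adds \<open>U M_hat U\<^sup>T\<close> to \<open>S\<close> and \<open>U K_hat U\<^sup>T\<close> to \<open>R\<close>.

  The deflating pairs: \<open>U\<^sup>T X\<^sub>c = I\<close> by the choice of \<open>U\<close>, and \<open>U\<^sup>T X\<^sub>f = 0\<close> because \<open>X\<^sub>c\<^sup>T S X\<^sub>f\<close> solves a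
  homogeneous Sylvester equation, and \<open>\<Lambda>\<^sub>c\<close> and \<open>-\<Lambda>\<^sub>f\<^sup>T\<close> have disjoint spectra
  (\<open>deflating_orthogonality\<close>). Hence \<open>(X\<^sub>f, \<Lambda>\<^sub>f)\<close> does not notice the update. For \<open>(X\<^sub>c, \<Lambda>\<^sub>a)\<close> the equation
  to be solved is \<open>M_hat \<Lambda>\<^sub>a + K_hat = G (\<Lambda>\<^sub>c - \<Lambda>\<^sub>a)\<close>, an identity in the given matrices
  (\<open>update_moves_spectrum\<close>). The matrices \<open>X\<^sub>c\<close> and \<open>X\<^sub>f\<close> are unchanged, so the pairs stay complementary.

  The structure: \<open>M_hat\<close> has to be skew-symmetric and \<open>K_hat\<close> symmetric. This rests on the relations
  \<open>G \<Lambda>\<^sub>a = -\<Lambda>\<^sub>a\<^sup>T G\<close> and \<open>G \<Lambda>\<^sub>a\<^sup>T = -\<Lambda>\<^sub>a G\<close>, and on the same relations for \<open>Z\<^sub>1\<close> and \<open>Z\<^sub>2\<close>, from which it follows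
  by commuting factors (\<open>update_structure\<close>). For \<open>Z\<^sub>1\<close> and \<open>Z\<^sub>2\<close> the relations are visible in the blocks.
  For \<open>G\<close> only \<open>G \<Lambda>\<^sub>c = -\<Lambda>\<^sub>c\<^sup>T G\<close> is known at first, and distinctness of the eigenvalues is what carries
  it over: there is a real polynomial \<open>q\<close>, odd on the eigenvalues of \<open>\<Lambda>\<^sub>c\<close>, that maps the old
  eigenvalues to the new ones, so \<open>\<Lambda>\<^sub>a = q(\<Lambda>\<^sub>c)\<close> and \<open>-\<Lambda>\<^sub>a\<^sup>T = q(-\<Lambda>\<^sub>c\<^sup>T)\<close>, and \<open>q\<close> preserves intertwining relations
  (\<open>Lam_mat_twist_transfer\<close>). The same applies to \<open>\<Lambda>\<^sub>a\<^sup>T\<close>, and shows that \<open>\<Lambda>\<^sub>c\<close>, \<open>\<Lambda>\<^sub>a\<close>, \<open>\<Lambda>\<^sub>a\<^sup>T\<close> commute.\<close>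

section \<open>Matrix algebra\<close>

text \<open>The ring laws are restated with equations between dimensions as premises: unlike membership in
  carriers, these leave no intermediate dimension for the simplifier to guess.\<close>

lemma mult_mat_assoc:
  fixes A :: "'a::semiring_0 mat"
  shows "dim_col A = dim_row B \<Longrightarrow> dim_col B = dim_row C \<Longrightarrow> (A * B) * C = A * (B * C)"
  by (rule assoc_mult_mat) auto

lemma transpose_mult_mat:
  fixes A :: "'a::comm_semiring_0 mat"
  shows "dim_col A = dim_row B \<Longrightarrow> (A * B)\<^sup>T = B\<^sup>T * A\<^sup>T"
  by (rule transpose_mult) auto

lemma mult_mat_add_distrib:
  fixes A :: "'a::semiring_0 mat"
  shows "dim_col A = dim_row B \<Longrightarrow> dim_row B = dim_row C \<Longrightarrow> dim_col B = dim_col C \<Longrightarrow>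
    A * (B + C) = A * B + A * C"
  by (rule mult_add_distrib_mat) auto

lemma add_mat_mult_distrib:
  fixes A :: "'a::semiring_0 mat"
  shows "dim_row A = dim_row B \<Longrightarrow> dim_col A = dim_col B \<Longrightarrow> dim_col B = dim_row C \<Longrightarrow>
    (A + B) * C = A * C + B * C"
  by (rule add_mult_distrib_mat) auto

lemma mult_mat_minus_distrib:
  fixes A :: "'a::ring mat"
  shows "dim_col A = dim_row B \<Longrightarrow> dim_row B = dim_row C \<Longrightarrow> dim_col B = dim_col C \<Longrightarrow>
    A * (B - C) = A * B - A * C"
  by (rule mult_minus_distrib_mat) auto

lemma minus_mat_mult_distrib:
  fixes A :: "'a::ring mat"
  shows "dim_row A = dim_row B \<Longrightarrow> dim_col A = dim_col B \<Longrightarrow> dim_col B = dim_row C \<Longrightarrow>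
    (A - B) * C = A * C - B * C"
  by (rule minus_mult_distrib_mat) auto

lemma inv_mat_inverse:
  fixes A :: "'a::field mat"
  assumes A: "A \<in> carrier_mat n n" and inv: "invertible_mat A"
  shows "inv_mat A \<in> carrier_mat n n" "A * inv_mat A = 1\<^sub>m n" "inv_mat A * A = 1\<^sub>m n"
proof -
  from inv obtain B where B: "A * B = 1\<^sub>m n" "B * A = 1\<^sub>m (dim_row B)"
    using A unfolding invertible_mat_def inverts_mat_def by auto
  have "B \<in> carrier_mat n n"
    using arg_cong[OF B(1), of dim_col] arg_cong[OF B(2), of dim_col] A by auto
  then have "A \<in> Units (ring_mat TYPE('a) n ())"
    using A B unfolding Units_def ring_mat_def by auto
  with mat_inverse(1)[OF A, where b = "()"] obtain C where C: "mat_inverse A = Some C" by (cases "mat_inverse A") auto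
  then show "inv_mat A \<in> carrier_mat n n" "A * inv_mat A = 1\<^sub>m n" "inv_mat A * A = 1\<^sub>m n"
    using mat_inverse(2)[OF A C] by (auto simp: inv_mat_def)
qed

text \<open>The matrix is positive definite: \<open>v\<^sup>T (A\<^sup>T A + I) v = |A v|\<^sup>2 + |v|\<^sup>2\<close>.\<close>
lemma invertible_transpose_mult_self_plus_one:
  fixes A :: "real mat"
  assumes A: "A \<in> carrier_mat n n"
  shows "invertible_mat (A\<^sup>T * A + 1\<^sub>m n)"
proof -
  let ?P = "A\<^sup>T * A + 1\<^sub>m n"
  have P: "?P \<in> carrier_mat n n" using A by auto
  have "v = 0\<^sub>v n" if v: "v \<in> carrier_vec n" and Pv: "?P *\<^sub>v v = 0\<^sub>v n" for v
  proof -
    have Av: "A *\<^sub>v v \<in> carrier_vec n" using A v by auto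
    have "?P *\<^sub>v v = A\<^sup>T *\<^sub>v (A *\<^sub>v v) + v"
      using A v by (subst add_mult_distrib_mat_vec[of _ n n]) (auto simp: assoc_mult_mat_vec[of _ n n _ n])
    then have "0 = v \<bullet> (A\<^sup>T *\<^sub>v (A *\<^sub>v v) + v)" using Pv scalar_prod_right_zero[OF v] by simp
    also have "\<dots> = v \<bullet> (A\<^sup>T *\<^sub>v (A *\<^sub>v v)) + v \<bullet> v"
      using A v by (subst scalar_prod_add_distrib[of _ n]) auto
    also have "v \<bullet> (A\<^sup>T *\<^sub>v (A *\<^sub>v v)) = (A *\<^sub>v v) \<bullet> (A *\<^sub>v v)"
      using transpose_vec_mult_scalar[OF A v Av] A v comm_scalar_prod[of v n] by simp
    finally have "(A *\<^sub>v v) \<bullet> (A *\<^sub>v v) + v \<bullet> v = 0" by simp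
    moreover have "(A *\<^sub>v v) \<bullet> (A *\<^sub>v v) \<ge> 0" "v \<bullet> v \<ge> 0"
      by (auto simp: scalar_prod_def intro!: sum_nonneg)
    ultimately have "v \<bullet> v = 0" by linarith
    then show ?thesis
      using v by (auto simp: scalar_prod_def sum_nonneg_eq_0_iff intro: eq_vecI)
  qed
  then have "det ?P \<noteq> 0" using det_0_iff_vec_prod_zero_field[OF P] by blast
  then have "?P \<in> Units (ring_mat TYPE(real) n ())" using det_non_zero_imp_unit[OF P, where b = "()"] by blast
  then show ?thesis
    using P unfolding Units_def ring_mat_def invertible_mat_def inverts_mat_def by auto
qed

section \<open>The symplectic unit matrix\<close>

lemma transpose_J_mat: "(J_mat n)\<^sup>T = - J_mat n"
  unfolding J_mat_def
  by (subst transpose_four_block_mat[of _ n n _ n _ n]) (auto intro: eq_matI simp: transpose_uminus)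

lemma J_mat_carrier [simp]: "J_mat n \<in> carrier_mat (2 * n) (2 * n)"
  unfolding J_mat_def by (auto simp: mult_2)

lemma J_mat_dim [simp]: "dim_row (J_mat n) = 2 * n" "dim_col (J_mat n) = 2 * n"
  using J_mat_carrier by blast+

lemma J_mat_square: "J_mat n * J_mat n = - 1\<^sub>m (2 * n)"
  unfolding J_mat_def
  by (subst mult_four_block_mat[of _ n n _ n _ n _ _ n _ n]) (auto intro!: eq_matI simp: mult_2)

lemma J_mat_orthogonal:
  "(J_mat n)\<^sup>T * J_mat n = 1\<^sub>m (2 * n)" "J_mat n * (J_mat n)\<^sup>T = 1\<^sub>m (2 * n)"
  by (simp_all add: transpose_J_mat J_mat_square)

section \<open>The homogeneous Sylvester equation\<close>

text \<open>Triangularise \<open>B = P T P\<^sup>-\<^sup>1\<close> and put \<open>V = W P\<close>, so that \<open>A V = V T\<close>. If the columns of \<open>V\<close> before the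
  \<open>j\<close>-th vanish, then the \<open>j\<close>-th column \<open>v\<close> satisfies \<open>A v = T\<^sub>j\<^sub>j v\<close>; as \<open>T\<^sub>j\<^sub>j\<close> is an eigenvalue of \<open>B\<close>, it is
  none of \<open>A\<close>, and \<open>v = 0\<close>.\<close>
lemma sylvester_trivial:
  fixes A B W :: "complex mat"
  assumes A: "A \<in> carrier_mat n n" and B: "B \<in> carrier_mat m m" and W: "W \<in> carrier_mat n m"
    and AW: "A * W = W * B" and disj: "spectrum B \<inter> spectrum A = {}"
  shows "W = 0\<^sub>m n m"
proof -
  obtain es where "char_poly B = (\<Prod>e\<leftarrow>es. [:- e, 1:])" using char_poly_factorized[OF B] by blast
  from schur_decomposition_exists[OF B this] obtain T
    where T: "T \<in> carrier_mat m m" and upper: "upper_triangular T" and sim: "similar_mat B T" by blast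
  from similar_matD[OF sim] obtain k P Q where k: "{B, T, P, Q} \<subseteq> carrier_mat k k"
    "P * Q = 1\<^sub>m k" "Q * P = 1\<^sub>m k" "B = P * T * Q" by blast
  have "k = m" using k(1) B by auto
  with k have PQ: "P \<in> carrier_mat m m" "Q \<in> carrier_mat m m"
    "P * Q = 1\<^sub>m m" "Q * P = 1\<^sub>m m" "B = P * T * Q" by simp_all
  define V where "V = W * P"
  have V: "V \<in> carrier_mat n m" using W PQ(1) by (auto simp: V_def)
  have AV: "A * V = V * T"
  proof -
    have "A * V = (A * W) * P" unfolding V_def using A W PQ(1) by (simp add: mult_mat_assoc)
    also have "\<dots> = W * (B * P)" unfolding AW using B W PQ(1) by (simp add: mult_mat_assoc)
    also have "B * P = P * T * (Q * P)" unfolding PQ(5) using PQ(1,2) T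
      by (simp add: mult_mat_assoc)
    also have "\<dots> = P * T" unfolding PQ(4) using PQ(1) T by simp
    finally show ?thesis using W PQ(1) T unfolding V_def by (simp add: mult_mat_assoc)
  qed
  have eigT: "T $$ (j, j) \<in> spectrum B" if "j < m" for j
  proof -
    have "char_poly B = char_poly T" using char_poly_similar[OF sim] .
    also have "\<dots> = (\<Prod>a\<leftarrow>diag_mat T. [:- a, 1:])" using char_poly_upper_triangular[OF T upper] .
    finally have "poly (char_poly B) (T $$ (j, j)) = 0"
      using that T by (auto simp: poly_prod_list prod_list_zero_iff diag_mat_def)
    then show ?thesis using eigenvalue_root_char_poly[OF B] by (simp add: spectrum_def)
  qed
  have col0: "col V j = 0\<^sub>v n" if "j < m" for j
    using that
  proof (induction j rule: less_induct)
    case (less j)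
    have "A *\<^sub>v col V j = T $$ (j, j) \<cdot>\<^sub>v col V j"
    proof (rule eq_vecI)
      fix i assume "i < dim_vec (T $$ (j, j) \<cdot>\<^sub>v col V j)"
      then have i: "i < n" using V by simp
      have "(A *\<^sub>v col V j) $ i = (A * V) $$ (i, j)" using A V i less.prems by simp
      also have "\<dots> = (\<Sum>k<m. V $$ (i, k) * T $$ (k, j))"
        unfolding AV using V T i less.prems by (simp add: scalar_prod_def atLeast0LessThan)
      also have "\<dots> = (\<Sum>k\<in>{j}. V $$ (i, k) * T $$ (k, j))"
      proof (rule sum.mono_neutral_right)
        show "\<forall>k\<in>{..<m} - {j}. V $$ (i, k) * T $$ (k, j) = 0"
        proof
          fix k assume k: "k \<in> {..<m} - {j}"
          show "V $$ (i, k) * T $$ (k, j) = 0"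
          proof (cases "k < j")
            case True
            from less.IH[OF True] k have "col V k $ i = 0" using i by simp
            then show ?thesis using V i k by simp
          next
            case False
            then show ?thesis using upper T k by (auto simp: upper_triangular_def)
          qed
        qed
      qed (use less.prems in auto)
      finally show "(A *\<^sub>v col V j) $ i = (T $$ (j, j) \<cdot>\<^sub>v col V j) $ i"
        using V i less.prems by simp
    qed (use A V in auto)
    then have "col V j \<noteq> 0\<^sub>v n \<Longrightarrow> T $$ (j, j) \<in> spectrum A"
      using A V by (auto simp: spectrum_def eigenvalue_def eigenvector_def intro!: exI[of _ "col V j"])
    then show ?case using eigT[OF less.prems] disj by blast
  qed
  have "V = 0\<^sub>m n m"
  proof (rule eq_matI)
    fix i j assume "i < dim_row (0\<^sub>m n m)" "j < dim_col (0\<^sub>m n m)"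
    then show "V $$ (i, j) = 0\<^sub>m n m $$ (i, j)"
      using arg_cong[OF col0[of j], of "\<lambda>v. v $ i"] V by simp
  qed (use V in auto)
  moreover have "W = V * Q" unfolding V_def using W PQ(1-3) by (simp add: mult_mat_assoc)
  ultimately show ?thesis using PQ(2) by simp
qed

section \<open>Polynomials of a matrix\<close>

definition mat_poly :: "'a::comm_ring_1 poly \<Rightarrow> 'a mat \<Rightarrow> 'a mat" where
  "mat_poly p A =
     fold_coeffs (\<lambda>a B. a \<cdot>\<^sub>m 1\<^sub>m (dim_row A) + A * B) p (0\<^sub>m (dim_row A) (dim_row A))"

lemma mat_poly_0: "mat_poly 0 A = 0\<^sub>m (dim_row A) (dim_row A)"
  by (simp add: mat_poly_def)

lemma mat_poly_pCons:
  assumes "square_mat A"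
  shows "mat_poly (pCons a p) A = a \<cdot>\<^sub>m 1\<^sub>m (dim_row A) + A * mat_poly p A"
proof (cases "a = 0 \<and> p = 0")
  case True
  then show ?thesis using assms by (auto simp: mat_poly_0 intro: eq_matI)
next
  case False
  then have "fold_coeffs (\<lambda>a B. a \<cdot>\<^sub>m 1\<^sub>m (dim_row A) + A * B) (pCons a p) =
      (\<lambda>B. a \<cdot>\<^sub>m 1\<^sub>m (dim_row A) + A * B) \<circ> fold_coeffs (\<lambda>a B. a \<cdot>\<^sub>m 1\<^sub>m (dim_row A) + A * B) p"
    by (cases "p = 0") (auto simp: fold_coeffs_pCons_coeff_not_0_eq fold_coeffs_pCons_not_0_0_eq)
  then show ?thesis by (simp add: mat_poly_def)
qed

lemma mat_poly_carrier:
  assumes A: "A \<in> carrier_mat n n"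
  shows "mat_poly p A \<in> carrier_mat n n"
  using A by (induction p) (auto simp: mat_poly_0 mat_poly_pCons)

text \<open>This is the reason for working with polynomials: a relation \<open>A W = W B\<close> is inherited by all of
  them. With \<open>A = B\<close> it says that whatever commutes with \<open>A\<close> commutes with \<open>p(A)\<close>.\<close>
lemma mat_poly_intertwine:
  assumes A: "A \<in> carrier_mat n n" and B: "B \<in> carrier_mat m m" and W: "W \<in> carrier_mat n m"
    and AW: "A * W = W * B"
  shows "mat_poly p A * W = W * mat_poly p B"
proof (induction p)
  case 0
  then show ?case using A B W by (simp add: mat_poly_0)
next
  case (pCons a p)
  note cA = mat_poly_carrier[OF A, of p] and cB = mat_poly_carrier[OF B, of p]
  have "A * mat_poly p A * W = A * W * mat_poly p B"
    using A W cA cB pCons.IH by (simp add: mult_mat_assoc)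
  also have "\<dots> = W * (B * mat_poly p B)"
    unfolding AW using B W cB by (simp add: mult_mat_assoc)
  finally show ?case
    using A B W cA cB
    by (simp add: mat_poly_pCons add_mat_mult_distrib mult_mat_add_distrib
        mult_smult_assoc_mat[of _ n n _ m] mult_smult_distrib[of _ n m _ m])
qed

lemma mat_poly_commute:
  assumes A: "A \<in> carrier_mat n n"
  shows "mat_poly p A * mat_poly q A = mat_poly q A * mat_poly p A"
proof -
  have "A * mat_poly q A = mat_poly q A * A"
    using mat_poly_intertwine[OF A A A refl] by metis
  from mat_poly_intertwine[OF A A mat_poly_carrier[OF A] this] show ?thesis .
qed

lemma mat_poly_four_block_diag:
  assumes A: "A \<in> carrier_mat n n" and B: "B \<in> carrier_mat m m"
  shows "mat_poly p (four_block_mat A (0\<^sub>m n m) (0\<^sub>m m n) B) =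
    four_block_mat (mat_poly p A) (0\<^sub>m n m) (0\<^sub>m m n) (mat_poly p B)"
proof (induction p)
  case 0
  show ?case using A B by (auto simp: mat_poly_0 intro: eq_matI)
next
  case (pCons a p)
  note cA = mat_poly_carrier[OF A, of p] and cB = mat_poly_carrier[OF B, of p]
  let ?F = "four_block_mat A (0\<^sub>m n m) (0\<^sub>m m n) B"
  have "?F * mat_poly p ?F =
      four_block_mat (A * mat_poly p A) (0\<^sub>m n m) (0\<^sub>m m n) (B * mat_poly p B)"
    unfolding pCons.IH using A B cA cB
    by (subst mult_four_block_mat[OF A _ _ B cA _ _ cB]) auto
  moreover have "a \<cdot>\<^sub>m 1\<^sub>m (n + m) + four_block_mat C (0\<^sub>m n m) (0\<^sub>m m n) D =
      four_block_mat (a \<cdot>\<^sub>m 1\<^sub>m n + C) (0\<^sub>m n m) (0\<^sub>m m n) (a \<cdot>\<^sub>m 1\<^sub>m m + D)"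
    if "C \<in> carrier_mat n n" "D \<in> carrier_mat m m" for C D
    using that by (intro eq_matI) auto
  ultimately show ?case using A B cA cB by (simp add: mat_poly_pCons)
qed

lemma mat_poly_diag_block_mat:
  assumes "\<And>A. A \<in> set As \<Longrightarrow> square_mat A"
  shows "mat_poly p (diag_block_mat As) = diag_block_mat (map (mat_poly p) As)"
  using assms
proof (induction As)
  case Nil
  have "mat_poly p (0\<^sub>m 0 0) \<in> carrier_mat 0 0" by (rule mat_poly_carrier) auto
  then have "mat_poly p (0\<^sub>m 0 0) = 0\<^sub>m 0 0" by (intro eq_matI) simp_all
  then show ?case by simp
next
  case (Cons A As)
  let ?B = "diag_block_mat As"
  obtain n where A: "A \<in> carrier_mat n n" using Cons.prems[of A] by auto
  have "square_mat ?B" by (rule diag_block_mat_square) (blast intro: Cons.prems list.set_intros)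
  then obtain m where B: "?B \<in> carrier_mat m m" by auto
  have IH: "mat_poly p ?B = diag_block_mat (map (mat_poly p) As)"
    by (rule Cons.IH) (rule Cons.prems, simp)
  show ?case
    using mat_poly_four_block_diag[OF A B, of p] carrier_matD[OF A] carrier_matD[OF B]
      carrier_matD[OF mat_poly_carrier[OF A, of p]] carrier_matD[OF mat_poly_carrier[OF B, of p]]
    by (simp add: Let_def flip: IH)
qed

lemma mult_diag_block_mat:
  fixes f g :: "'i \<Rightarrow> 'a::semiring_0 mat"
  assumes "\<And>i. i \<in> set is \<Longrightarrow> f i \<in> carrier_mat (d i) (d i)"
    and "\<And>i. i \<in> set is \<Longrightarrow> g i \<in> carrier_mat (d i) (d i)"
  shows "diag_block_mat (map f is) * diag_block_mat (map g is) =
    diag_block_mat (map (\<lambda>i. f i * g i) is)"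
  using assms
proof (induction "is")
  case Nil
  then show ?case by auto
next
  case (Cons i "is")
  let ?D = "\<lambda>h. diag_block_mat (map h is)"
  let ?n = "sum_list (map d is)"
  have car: "?D h \<in> carrier_mat ?n ?n" if "\<And>i. i \<in> set is \<Longrightarrow> h i \<in> carrier_mat (d i) (d i)"
    for h :: "'i \<Rightarrow> 'a mat"
  proof -
    have "map (dim_row \<circ> h) is = map d is" "map (dim_col \<circ> h) is = map d is"
      using that by auto
    then have "dim_row (?D h) = ?n" "dim_col (?D h) = ?n"
      by (simp_all only: dim_diag_block_mat map_map)
    then show ?thesis by blast
  qed
  have f: "?D f \<in> carrier_mat ?n ?n" and g: "?D g \<in> carrier_mat ?n ?n"
    and fg: "?D (\<lambda>i. f i * g i) \<in> carrier_mat ?n ?n"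
    by (rule car; use Cons.prems in \<open>auto intro!: mult_carrier_mat\<close>)+
  have fi: "f i \<in> carrier_mat (d i) (d i)" and gi: "g i \<in> carrier_mat (d i) (d i)"
    using Cons.prems by auto
  have IH: "?D f * ?D g = ?D (\<lambda>i. f i * g i)" using Cons by auto
  show ?case
    using fi gi f g fg
    by (simp add: Let_def mult_four_block_mat[OF fi _ _ f gi _ _ g] IH)
qed

lemma transpose_diag_block_mat:
  "(diag_block_mat As)\<^sup>T = diag_block_mat (map transpose_mat As)"
proof (induction As)
  case (Cons A As)
  show ?case
    using Cons
    by (simp add: Let_def transpose_four_block_mat[of _ "dim_row A" "dim_col A" _
          "dim_col (diag_block_mat As)" _ "dim_row (diag_block_mat As)"]) (metis index_transpose_mat(2,3))
qed auto

lemma uminus_diag_block_mat: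
  fixes As :: "'a::group_add mat list"
  shows "- diag_block_mat As = diag_block_mat (map uminus As)"
proof (induction As)
  case (Cons A As)
  then show ?case by (auto simp: Let_def Cons[symmetric] intro: eq_matI)
qed auto

section \<open>The block matrix of the eigenvalues\<close>

lemma mat2_dim [simp]: "dim_row (mat2 a b c d) = 2" "dim_col (mat2 a b c d) = 2"
  by (simp_all add: mat2_def mat_of_rows_list_def)

lemma mat2_carrier [simp]: "mat2 a b c d \<in> carrier_mat 2 2"
  by (rule carrier_matI) simp_all

lemma mat2_index [simp]:
  "mat2 a b c d $$ (0, 0) = a" "mat2 a b c d $$ (0, Suc 0) = b"
  "mat2 a b c d $$ (Suc 0, 0) = c" "mat2 a b c d $$ (Suc 0, Suc 0) = d"
  by (simp_all add: mat2_def mat_of_rows_list_def)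

lemma mat2_eqI:
  assumes "A \<in> carrier_mat 2 2" "B \<in> carrier_mat 2 2"
    "A $$ (0, 0) = B $$ (0, 0)" "A $$ (0, Suc 0) = B $$ (0, Suc 0)"
    "A $$ (Suc 0, 0) = B $$ (Suc 0, 0)" "A $$ (Suc 0, Suc 0) = B $$ (Suc 0, Suc 0)"
  shows "A = B"
  using assms by (intro eq_matI) (auto simp: numeral_2_eq_2 less_Suc_eq)

lemma mat2_mult: "mat2 a b c d * mat2 a' b' c' d' =
    mat2 (a * a' + b * c') (a * b' + b * d') (c * a' + d * c') (c * b' + d * d' :: 'a::semiring_0)"
  by (rule mat2_eqI) (auto simp: scalar_prod_def numeral_2_eq_2 intro!: mult_carrier_mat)

lemma mat2_add: "mat2 a b c d + mat2 a' b' c' d' = mat2 (a + a') (b + b') (c + c') (d + d')"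
  by (rule mat2_eqI) auto

lemma mat2_uminus: "- mat2 a b c d = mat2 (- a) (- b) (- c) (- d :: 'a::group_add)"
  by (rule mat2_eqI) auto

lemma mat2_transpose: "(mat2 a b c d)\<^sup>T = mat2 a c b d"
  by (rule mat2_eqI) auto

lemma mat2_one: "a \<cdot>\<^sub>m 1\<^sub>m 2 = mat2 a 0 0 (a :: 'a::semiring_1)"
  by (rule mat2_eqI) auto

lemma mat2_smult: "k \<cdot>\<^sub>m mat2 a b c d = mat2 (k * a) (k * b) (k * c) (k * d)"
  by (rule mat2_eqI) auto

lemma mat2_zero: "0\<^sub>m 2 2 = mat2 0 0 0 0"
  by (rule mat2_eqI) auto

lemmas mat2_simps = mat2_mult mat2_add mat2_uminus mat2_transpose mat2_one mat2_smult mat2_zero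

text \<open>The map \<open>Lam_hat\<close> embeds the real algebra of complex numbers into the real 2x2 matrices, and
  thus commutes with polynomials that have real coefficients.\<close>
lemma mat_poly_Lam_hat:
  "mat_poly p (Lam_hat \<mu>) = Lam_hat (poly (map_poly of_real p) \<mu>)"
proof (induction p)
  case 0
  show ?case by (simp add: mat_poly_0 Lam_hat_def mat2_zero)
next
  case (pCons a p)
  have "square_mat (Lam_hat \<mu>)" "dim_row (Lam_hat \<mu>) = 2" by (simp_all add: Lam_hat_def)
  then have eq: "mat_poly (pCons a p) (Lam_hat \<mu>) = a \<cdot>\<^sub>m 1\<^sub>m 2 + Lam_hat \<mu> * mat_poly p (Lam_hat \<mu>)"
    by (simp add: mat_poly_pCons)
  note eq
  also have "a \<cdot>\<^sub>m 1\<^sub>m 2 + Lam_hat \<mu> * mat_poly p (Lam_hat \<mu>) = Lam_hat (of_real a + \<mu> * poly (map_poly of_real p) \<mu>)"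
    unfolding pCons.IH by (simp add: Lam_hat_def mat2_simps) (rule mat2_eqI; simp)
  also have "of_real a + \<mu> * poly (map_poly of_real p) \<mu> = poly (map_poly of_real (pCons a p)) \<mu>"
    using pCons.hyps by (simp add: map_poly_pCons)
  finally show ?case .
qed

lemma mat_poly_diag2:
  "mat_poly p (mat2 a 0 0 b) = mat2 (poly p a) 0 0 (poly p b)"
proof (induction p)
  case 0
  show ?case by (simp add: mat_poly_0 mat2_zero)
next
  case (pCons c p)
  have "mat_poly (pCons c p) (mat2 a 0 0 b) = c \<cdot>\<^sub>m 1\<^sub>m 2 + mat2 a 0 0 b * mat_poly p (mat2 a 0 0 b)"
    by (simp add: mat_poly_pCons)
  then show ?case unfolding pCons.IH by (simp add: mat2_simps)
qed

lemma Lam_hat_neg_cnj: "Lam_hat (- cnj \<mu>) = - (Lam_hat \<mu>)\<^sup>T"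
  by (simp add: Lam_hat_def mat2_simps)

definition Lam_block :: "nat \<Rightarrow> nat \<Rightarrow> (nat \<Rightarrow> complex) \<Rightarrow> nat \<Rightarrow> real mat" where
  "Lam_block m1 m2 ev = by_kind m1 m2
     (\<lambda>j. diag_block_mat [Lam_hat (ev j), - (Lam_hat (ev j))\<^sup>T])
     (\<lambda>k. mat2 0 (Im (ev k)) (- Im (ev k)) 0)
     (\<lambda>l. mat2 (Re (ev l)) 0 0 (- Re (ev l)))"

lemma Lam_mat_eq: "Lam_mat m1 m2 p ev = diag_block_mat (map (Lam_block m1 m2 ev) [1..<Suc p])"
  by (simp only: Lam_mat_def Lam_block_def)

definition block_dim :: "nat \<Rightarrow> nat \<Rightarrow> nat" where
  "block_dim m1 i = (if i \<le> m1 then 4 else 2)"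

lemma Lam_hat_carrier [simp]: "Lam_hat \<mu> \<in> carrier_mat 2 2"
  by (simp add: Lam_hat_def)

lemma diag_block_mat_pair:
  "A \<in> carrier_mat 2 2 \<Longrightarrow> B \<in> carrier_mat 2 2 \<Longrightarrow>
    diag_block_mat [A, B] = four_block_mat A (0\<^sub>m 2 2) (0\<^sub>m 2 2) B"
  by (intro eq_matI) (auto simp: Let_def)

lemma Lam_block_carrier: "Lam_block m1 m2 ev i \<in> carrier_mat (block_dim m1 i) (block_dim m1 i)"
  by (auto simp: Lam_block_def by_kind_def block_dim_def Let_def Lam_hat_def)

lemma sum_block_dim: "sum_list (map (block_dim m1) [1..<Suc p]) = 2 * min m1 p + 2 * p"
  by (induction p) (auto simp: block_dim_def[of m1 "Suc _"])

lemma diag_block_mat_block_dim_carrier: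
  assumes "m1 \<le> p" and "\<And>i. F i \<in> carrier_mat (block_dim m1 i) (block_dim m1 i)"
  shows "diag_block_mat (map F [1..<Suc p]) \<in> carrier_mat (2 * m1 + 2 * p) (2 * m1 + 2 * p)"
proof -
  have "dim_row \<circ> F = block_dim m1" "dim_col \<circ> F = block_dim m1" using assms(2) by (auto simp: fun_eq_iff)
  then have "dim_row (diag_block_mat (map F [1..<Suc p])) = 2 * m1 + 2 * p"
    "dim_col (diag_block_mat (map F [1..<Suc p])) = 2 * m1 + 2 * p"
    using sum_block_dim[of m1 p] assms(1) by (simp_all only: dim_diag_block_mat map_map min_absorb1)
  then show ?thesis by blast
qed

lemma Lam_mat_carrier:
  assumes "m1 \<le> p"
  shows "Lam_mat m1 m2 p ev \<in> carrier_mat (2 * m1 + 2 * p) (2 * m1 + 2 * p)"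
  unfolding Lam_mat_eq by (rule diag_block_mat_block_dim_carrier[OF assms Lam_block_carrier])

text \<open>The matrix \<open>-\<Lambda>\<^sup>T\<close> is of the same shape as \<open>\<Lambda>\<close>. This turns the relation
  \<open>G \<Lambda> = -\<Lambda>\<^sup>T G\<close> into an intertwining relation between two matrices of eigenvalues.\<close>
lemma Lam_mat_neg_cnj: "Lam_mat m1 m2 p (\<lambda>i. - cnj (ev i)) = - (Lam_mat m1 m2 p ev)\<^sup>T"
proof -
  have "Lam_block m1 m2 (\<lambda>i. - cnj (ev i)) i = - (Lam_block m1 m2 ev i)\<^sup>T" for i
    by (simp add: Lam_block_def by_kind_def Lam_hat_neg_cnj mat2_simps transpose_diag_block_mat
        uminus_diag_block_mat transpose_uminus del: diag_block_mat.simps)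
  then show ?thesis
    by (simp add: Lam_mat_eq transpose_diag_block_mat uminus_diag_block_mat o_def cong: map_cong del: upt_Suc)
qed

lemma Lam_mat_cnj: "Lam_mat m1 m2 p (\<lambda>i. cnj (ev i)) = (Lam_mat m1 m2 p ev)\<^sup>T"
proof -
  have "Lam_block m1 m2 (\<lambda>i. cnj (ev i)) i = (Lam_block m1 m2 ev i)\<^sup>T" for i
    by (simp add: Lam_block_def by_kind_def mat2_simps transpose_diag_block_mat Lam_hat_def
        transpose_uminus del: diag_block_mat.simps)
  then show ?thesis
    by (simp add: Lam_mat_eq transpose_diag_block_mat o_def cong: map_cong del: upt_Suc)
qed

section \<open>A real polynomial that moves the eigenvalues\<close>

lemma interpolation:
  fixes f :: "'a::field \<Rightarrow> 'a"
  assumes "finite S"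
  shows "\<exists>p. \<forall>z\<in>S. poly p z = f z"
  using assms
proof (induction S)
  case (insert x S)
  then obtain p where p: "\<forall>z\<in>S. poly p z = f z" by blast
  define r where "r = (\<Prod>s\<in>S. [:- s, 1:])"
  have r: "poly r z = 0 \<longleftrightarrow> z \<in> S" for z
    using insert.hyps(1) by (auto simp: r_def poly_prod)
  define q where "q = p + Polynomial.smult ((f x - poly p x) / poly r x) r"
  have "\<forall>z\<in>insert x S. poly q z = f z"
    using p r insert.hyps(2) by (auto simp: q_def)
  then show ?case by blast
qed simp

lemma map_poly_pCons_zero: "f 0 = 0 \<Longrightarrow> map_poly f (pCons a p) = pCons (f a) (map_poly f p)"
  by (simp add: poly_eq_iff coeff_map_poly coeff_pCons split: nat.split)

lemma poly_map_poly_Re: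
  "2 * poly (map_poly complex_of_real (map_poly Re p)) z = poly p z + cnj (poly p (cnj z))"
proof (induction p)
  case (pCons a p)
  have "complex_of_real (Re a) * 2 = a + cnj a" by (simp add: complex_eq_iff)
  then show ?case using pCons
    by (simp add: map_poly_pCons_zero algebra_simps)
qed simp

lemma poly_map_poly_of_real:
  "poly (map_poly complex_of_real p) (of_real x) = of_real (poly p x)"
  by (induction p) (auto simp: map_poly_pCons_zero)

text \<open>For data that are symmetric under conjugation, the real part of an interpolating polynomial
  interpolates as well.\<close>
lemma real_interpolation:
  assumes "finite S" and "\<And>z. z \<in> S \<Longrightarrow> cnj z \<in> S" and "\<And>z. z \<in> S \<Longrightarrow> f (cnj z) = cnj (f z)"
  shows "\<exists>q. \<forall>z\<in>S. poly (map_poly complex_of_real q) z = f z"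
proof -
  from interpolation[OF assms(1), of f] obtain p where p: "\<forall>z\<in>S. poly p z = f z" by blast
  have "poly (map_poly of_real (map_poly Re p)) z = f z" if "z \<in> S" for z
    using poly_map_poly_Re[of p z] that p assms(2,3)[OF that] by simp
  then show ?thesis by blast
qed

lemma exists_map_eq:
  assumes "distinct xs" "length xs = length ys"
  shows "\<exists>f. map f xs = ys"
proof (intro exI nth_equalityI)
  let ?f = "the \<circ> map_of (zip xs ys)"
  show "length (map ?f xs) = length ys" using assms by simp
  fix i assume "i < length (map ?f xs)"
  then show "map ?f xs ! i = ys ! i"
    using assms by (simp add: map_of_zip_nth)
qed

lemma map_concat_eqD:
  assumes "map f (concat (map b is)) = concat (map b' is)"
    and "\<And>i. i \<in> set is \<Longrightarrow> length (b i) = length (b' i)" and "i \<in> set is"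
  shows "map f (b i) = b' i"
  using assms by (induction "is") (auto simp: append_eq_append_conv)

lemma eigenvalue_kinds_cnj:
  "eigenvalue_kinds m1 m2 p ev \<Longrightarrow> eigenvalue_kinds m1 m2 p (\<lambda>i. cnj (ev i))"
  by (simp add: eigenvalue_kinds_def)

lemma eigenvalue_kinds_neg_cnj:
  "eigenvalue_kinds m1 m2 p ev \<Longrightarrow> eigenvalue_kinds m1 m2 p (\<lambda>i. - cnj (ev i))"
  by (simp add: eigenvalue_kinds_def)

text \<open>Distinctness of the eigenvalues makes the assignment of new to old eigenvalues a function, and
  the way the eigenvalues are grouped makes it compatible with conjugation. The second condition on
  the polynomial expresses its oddness, in the form in which it is applied to \<open>-\<Lambda>\<^sup>T\<close>.\<close>
lemma real_polynomial_between_eigenvalues: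
  assumes dist: "distinct (changed_eigenvalues m1 m2 p ev)"
    and ev: "eigenvalue_kinds m1 m2 p ev" and ev': "eigenvalue_kinds m1 m2 p ev'"
  shows "\<exists>q. \<forall>i\<in>{1..p}. poly (map_poly complex_of_real q) (ev i) = ev' i \<and>
    poly (map_poly complex_of_real q) (- cnj (ev i)) = - cnj (ev' i)"
proof -
  define b :: "(nat \<Rightarrow> complex) \<Rightarrow> nat \<Rightarrow> complex list" where "b e = by_kind m1 m2
     (\<lambda>j. [e j, cnj (e j), - cnj (e j), - e j]) (\<lambda>k. [e k, cnj (e k)]) (\<lambda>l. [e l, - e l])" for e
  have ch: "changed_eigenvalues m1 m2 p e = concat (map (b e) [1..<Suc p])" for e
    by (simp only: changed_eigenvalues_def b_def)
  have len: "length (b ev i) = length (b ev' i)" for i by (simp add: b_def by_kind_def)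
  then have "length \<circ> b ev = length \<circ> b ev'" by (simp add: fun_eq_iff)
  then have "length (changed_eigenvalues m1 m2 p ev) = length (changed_eigenvalues m1 m2 p ev')"
    by (simp only: ch length_concat map_map)
  from exists_map_eq[OF dist this] obtain f
    where f: "map f (changed_eigenvalues m1 m2 p ev) = changed_eigenvalues m1 m2 p ev'" by blast
  have fb: "map f (b ev i) = b ev' i" if "i \<in> {1..p}" for i
    using map_concat_eqD[OF f[unfolded ch] len] that by (auto simp del: upt_Suc)
  let ?S = "set (changed_eigenvalues m1 m2 p ev)"
  have S: "?S = (\<Union>i\<in>{1..p}. set (b ev i))" by (simp add: ch atLeastLessThanSuc_atLeastAtMost del: upt_Suc)
  have kinds: "m1 < i \<Longrightarrow> i \<le> m2 \<Longrightarrow> Re (ev i) = 0 \<and> Re (ev' i) = 0"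
    "m1 < i \<Longrightarrow> m2 < i \<Longrightarrow> Im (ev i) = 0 \<and> Im (ev' i) = 0" if "i \<in> {1..p}" for i
    using ev ev' that by (auto simp: eigenvalue_kinds_def)
  have real: "Im z = 0 \<Longrightarrow> cnj z = z" and imag: "Re z = 0 \<Longrightarrow> cnj z = - z" for z
    by (auto simp: complex_eq_iff)
  have conj: "cnj z \<in> ?S \<and> f (cnj z) = cnj (f z)" if "z \<in> ?S" for z
  proof -
    from that obtain i where i: "i \<in> {1..p}" "z \<in> set (b ev i)" unfolding S by blast
    have "cnj z \<in> set (b ev i) \<and> f (cnj z) = cnj (f z)"
      using i(2) fb[OF i(1)] kinds[OF i(1)]
      by (auto simp: b_def by_kind_def real split: if_splits)
    then show ?thesis using i(1) S by blast
  qed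
  from real_interpolation[of ?S f] conj obtain q
    where q: "\<forall>z\<in>?S. poly (map_poly complex_of_real q) z = f z" by auto
  have "poly (map_poly complex_of_real q) (ev i) = ev' i \<and>
    poly (map_poly complex_of_real q) (- cnj (ev i)) = - cnj (ev' i)" if i: "i \<in> {1..p}" for i
  proof -
    have "poly (map_poly complex_of_real q) z = f z" if "z \<in> set (b ev i)" for z
      using q i that unfolding S by blast
    then show ?thesis using fb[OF i] kinds[OF i]
      by (auto simp: b_def by_kind_def real imag split: if_splits)
  qed
  then show ?thesis by blast
qed

lemma mat_poly_Lam_mat:
  assumes ev: "eigenvalue_kinds m1 m2 p ev" and ev': "eigenvalue_kinds m1 m2 p ev'"
    and q: "\<And>i. i \<in> {1..p} \<Longrightarrow> poly (map_poly complex_of_real q) (ev i) = ev' i \<and>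
      poly (map_poly complex_of_real q) (- cnj (ev i)) = - cnj (ev' i)"
  shows "mat_poly q (Lam_mat m1 m2 p ev) = Lam_mat m1 m2 p ev'"
proof -
  have block: "mat_poly q (Lam_block m1 m2 ev i) = Lam_block m1 m2 ev' i" if i: "i \<in> {1..p}" for i
  proof -
    consider "i \<le> m1" | "m1 < i" "i \<le> m2" | "m1 < i" "m2 < i" by linarith
    then show ?thesis
    proof cases
      case 1
      have "mat_poly q (diag_block_mat [Lam_hat \<mu>, Lam_hat \<nu>]) =
          diag_block_mat [mat_poly q (Lam_hat \<mu>), mat_poly q (Lam_hat \<nu>)]" for \<mu> \<nu>
        by (subst mat_poly_diag_block_mat) (auto simp: Lam_hat_def)
      with 1 show ?thesis
        by (simp add: Lam_block_def by_kind_def mat_poly_Lam_hat q[OF i]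
            del: diag_block_mat.simps flip: Lam_hat_neg_cnj)
    next
      case 2
      have "Re (ev i) = 0" "Re (ev' i) = 0" using ev ev' i 2 by (auto simp: eigenvalue_kinds_def)
      then have "Lam_block m1 m2 ev i = Lam_hat (ev i)" "Lam_block m1 m2 ev' i = Lam_hat (ev' i)"
        using 2 by (simp_all add: Lam_block_def by_kind_def Lam_hat_def)
      then show ?thesis using q[OF i] by (simp add: mat_poly_Lam_hat)
    next
      case 3
      have "Im (ev i) = 0" "Im (ev' i) = 0" using ev ev' i 3 by (auto simp: eigenvalue_kinds_def)
      then have re: "of_real (Re (ev i)) = ev i" "of_real (Re (ev' i)) = ev' i" "cnj (ev i) = ev i"
        "cnj (ev' i) = ev' i" by (simp_all add: complex_eq_iff)
      have "poly q (Re (ev i)) = Re (ev' i)" "poly q (- Re (ev i)) = - Re (ev' i)"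
        using q[OF i] poly_map_poly_of_real[of q "Re (ev i)"] poly_map_poly_of_real[of q "- Re (ev i)"]
          re by (auto simp: complex_eq_iff)
      then show ?thesis using 3 by (simp add: Lam_block_def by_kind_def mat_poly_diag2)
    qed
  qed
  have "map (mat_poly q \<circ> Lam_block m1 m2 ev) [1..<Suc p] = map (Lam_block m1 m2 ev') [1..<Suc p]"
    using block by (intro map_cong) auto
  moreover have "mat_poly q (Lam_mat m1 m2 p ev) =
      diag_block_mat (map (mat_poly q) (map (Lam_block m1 m2 ev) [1..<Suc p]))"
    unfolding Lam_mat_eq using carrier_matD[OF Lam_block_carrier[of m1 m2 ev]]
    by (intro mat_poly_diag_block_mat) auto
  ultimately show ?thesis by (simp only: map_map Lam_mat_eq)
qed

text \<open>Let \<open>q\<close> be the real polynomial that moves the eigenvalues. The new matrix is \<open>q(\<Lambda>)\<close>, and \<open>q\<close>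
  sends \<open>-\<Lambda>\<^sup>T\<close> to minus the transpose of the new matrix, so the relation between \<open>\<Lambda>\<close> and \<open>-\<Lambda>\<^sup>T\<close> passes
  to their images under \<open>q\<close>.\<close>
lemma Lam_mat_twist_transfer:
  assumes dist: "distinct (changed_eigenvalues m1 m2 p ev)" and "m1 \<le> p"
    and ev: "eigenvalue_kinds m1 m2 p ev" and ev': "eigenvalue_kinds m1 m2 p ev'"
    and G: "G \<in> carrier_mat (2 * m1 + 2 * p) (2 * m1 + 2 * p)"
    and twist: "G * Lam_mat m1 m2 p ev = - (Lam_mat m1 m2 p ev)\<^sup>T * G"
  shows "G * Lam_mat m1 m2 p ev' = - (Lam_mat m1 m2 p ev')\<^sup>T * G"
proof -
  from real_polynomial_between_eigenvalues[OF dist ev ev'] obtain q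
    where q: "\<And>i. i \<in> {1..p} \<Longrightarrow> poly (map_poly complex_of_real q) (ev i) = ev' i \<and>
      poly (map_poly complex_of_real q) (- cnj (ev i)) = - cnj (ev' i)" by blast
  have *: "mat_poly q (Lam_mat m1 m2 p ev) = Lam_mat m1 m2 p ev'"
    using mat_poly_Lam_mat[OF ev ev'] q by blast
  have **: "mat_poly q (Lam_mat m1 m2 p (\<lambda>i. - cnj (ev i))) = Lam_mat m1 m2 p (\<lambda>i. - cnj (ev' i))"
    by (rule mat_poly_Lam_mat[OF eigenvalue_kinds_neg_cnj[OF ev] eigenvalue_kinds_neg_cnj[OF ev']])
      (simp add: q)
  have "mat_poly q (Lam_mat m1 m2 p (\<lambda>i. - cnj (ev i))) * G = G * mat_poly q (Lam_mat m1 m2 p ev)"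
    by (rule mat_poly_intertwine[OF Lam_mat_carrier[OF \<open>m1 \<le> p\<close>] Lam_mat_carrier[OF \<open>m1 \<le> p\<close>] G])
      (simp add: twist Lam_mat_neg_cnj)
  then show ?thesis unfolding * ** unfolding Lam_mat_neg_cnj by simp
qed

text \<open>Both factors are polynomials of the same matrix.\<close>
lemma Lam_mat_commute:
  assumes dist: "distinct (changed_eigenvalues m1 m2 p ev)" and "m1 \<le> p"
    and ev: "eigenvalue_kinds m1 m2 p ev"
    and ev1: "eigenvalue_kinds m1 m2 p ev1" and ev2: "eigenvalue_kinds m1 m2 p ev2"
  shows "Lam_mat m1 m2 p ev1 * Lam_mat m1 m2 p ev2 = Lam_mat m1 m2 p ev2 * Lam_mat m1 m2 p ev1"
proof -
  have "\<exists>q. mat_poly q (Lam_mat m1 m2 p ev) = Lam_mat m1 m2 p ev'"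
    if ev': "eigenvalue_kinds m1 m2 p ev'" for ev'
    using real_polynomial_between_eigenvalues[OF dist ev ev'] mat_poly_Lam_mat[OF ev ev'] by blast
  with ev1 ev2 mat_poly_commute[OF Lam_mat_carrier[OF \<open>m1 \<le> p\<close>]] show ?thesis by metis
qed

section \<open>The matrices of the free parameters\<close>

definition Z1_block :: "nat \<Rightarrow> nat \<Rightarrow> (nat \<Rightarrow> real) \<Rightarrow> (nat \<Rightarrow> real) \<Rightarrow> nat \<Rightarrow> real mat" where
  "Z1_block m1 m2 \<alpha> \<beta> = by_kind m1 m2
     (\<lambda>j. four_block_mat
        (0\<^sub>m 2 2) (\<alpha> j \<cdot>\<^sub>m 1\<^sub>m 2 + \<beta> j \<cdot>\<^sub>m J2)
        ((- \<alpha> j) \<cdot>\<^sub>m 1\<^sub>m 2 + \<beta> j \<cdot>\<^sub>m J2) (0\<^sub>m 2 2))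
     (\<lambda>k. \<beta> k \<cdot>\<^sub>m J2)
     (\<lambda>l. \<beta> l \<cdot>\<^sub>m J2)"

definition Z2_block :: "nat \<Rightarrow> nat \<Rightarrow> (nat \<Rightarrow> real) \<Rightarrow> (nat \<Rightarrow> real) \<Rightarrow> nat \<Rightarrow> real mat" where
  "Z2_block m1 m2 u v = by_kind m1 m2
     (\<lambda>j. four_block_mat
        (0\<^sub>m 2 2) (u j \<cdot>\<^sub>m 1\<^sub>m 2 + v j \<cdot>\<^sub>m J2)
        (u j \<cdot>\<^sub>m 1\<^sub>m 2 - v j \<cdot>\<^sub>m J2) (0\<^sub>m 2 2))
     (\<lambda>k. u k \<cdot>\<^sub>m 1\<^sub>m 2)
     (\<lambda>l. u l \<cdot>\<^sub>m mat2 0 1 1 0)"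

lemma Z1_mat_eq: "Z1_mat m1 m2 p \<alpha> \<beta> = diag_block_mat (map (Z1_block m1 m2 \<alpha> \<beta>) [1..<Suc p])"
  by (simp only: Z1_mat_def Z1_block_def)

lemma Z2_mat_eq: "Z2_mat m1 m2 p u v = diag_block_mat (map (Z2_block m1 m2 u v) [1..<Suc p])"
  by (simp only: Z2_mat_def Z2_block_def)

lemma mat2_minus: "mat2 a b c d - mat2 a' b' c' d' = mat2 (a - a') (b - b') (c - c') (d - d' :: 'a::group_add)"
  by (rule mat2_eqI) auto

lemma four_block_mat2_transpose:
  assumes "A \<in> carrier_mat 2 2" "B \<in> carrier_mat 2 2"
  shows "(four_block_mat (0\<^sub>m 2 2) A B (0\<^sub>m 2 2))\<^sup>T = four_block_mat (0\<^sub>m 2 2) B\<^sup>T A\<^sup>T (0\<^sub>m 2 2)"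
  using assms by (subst transpose_four_block_mat[of _ 2 2 _ 2 _ 2]) auto

lemma four_block_mat2_uminus:
  fixes A :: "'a::group_add mat"
  assumes "A \<in> carrier_mat 2 2" "B \<in> carrier_mat 2 2"
  shows "- four_block_mat (0\<^sub>m 2 2) A B (0\<^sub>m 2 2) = four_block_mat (0\<^sub>m 2 2) (- A) (- B) (0\<^sub>m 2 2)"
  using assms by (intro eq_matI) auto

text \<open>In the quadruple blocks all 2x2 matrices involved have the form \<open>a I + b J\<^sub>2\<close>, hence commute.\<close>
lemma four_block_mat2_intertwine:
  fixes A :: "'a::semiring_0 mat"
  assumes "A \<in> carrier_mat 2 2" "B \<in> carrier_mat 2 2" "C \<in> carrier_mat 2 2" "D \<in> carrier_mat 2 2"
    and "A * D = D * A" "B * C = C * B"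
  shows "four_block_mat (0\<^sub>m 2 2) A B (0\<^sub>m 2 2) * diag_block_mat [C, D] =
    diag_block_mat [D, C] * four_block_mat (0\<^sub>m 2 2) A B (0\<^sub>m 2 2)"
  using assms
  by (simp add: diag_block_mat_pair mult_four_block_mat[of _ 2 2 _ 2 _ 2 _ _ 2 _ 2]
      del: diag_block_mat.simps)

lemma Z1_block_carrier: "Z1_block m1 m2 \<alpha> \<beta> i \<in> carrier_mat (block_dim m1 i) (block_dim m1 i)"
  by (auto simp: Z1_block_def by_kind_def J2_def block_dim_def)

lemma Z2_block_carrier: "Z2_block m1 m2 u v i \<in> carrier_mat (block_dim m1 i) (block_dim m1 i)"
  by (auto simp: Z2_block_def by_kind_def J2_def block_dim_def)

lemma Z1_mat_carrier:
  "m1 \<le> p \<Longrightarrow> Z1_mat m1 m2 p \<alpha> \<beta> \<in> carrier_mat (2 * m1 + 2 * p) (2 * m1 + 2 * p)"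
  unfolding Z1_mat_eq by (rule diag_block_mat_block_dim_carrier[OF _ Z1_block_carrier])

lemma Z2_mat_carrier:
  "m1 \<le> p \<Longrightarrow> Z2_mat m1 m2 p u v \<in> carrier_mat (2 * m1 + 2 * p) (2 * m1 + 2 * p)"
  unfolding Z2_mat_eq by (rule diag_block_mat_block_dim_carrier[OF _ Z2_block_carrier])

lemma Z1_mat_skew: "(Z1_mat m1 m2 p \<alpha> \<beta>)\<^sup>T = - Z1_mat m1 m2 p \<alpha> \<beta>"
proof -
  have "(Z1_block m1 m2 \<alpha> \<beta> i)\<^sup>T = - Z1_block m1 m2 \<alpha> \<beta> i" for i
    by (simp add: Z1_block_def by_kind_def J2_def mat2_one mat2_smult mat2_add mat2_transpose
        mat2_uminus four_block_mat2_transpose four_block_mat2_uminus)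
  then show ?thesis
    by (simp add: Z1_mat_eq transpose_diag_block_mat uminus_diag_block_mat o_def
        cong: map_cong del: upt_Suc)
qed

lemma Z2_mat_symmetric: "(Z2_mat m1 m2 p u v)\<^sup>T = Z2_mat m1 m2 p u v"
proof -
  have "(Z2_block m1 m2 u v i)\<^sup>T = Z2_block m1 m2 u v i" for i
    by (simp add: Z2_block_def by_kind_def J2_def mat2_one mat2_smult mat2_add mat2_minus
        mat2_transpose four_block_mat2_transpose)
  then show ?thesis
    by (simp add: Z2_mat_eq transpose_diag_block_mat o_def cong: map_cong del: upt_Suc)
qed

lemma diag_block_mat_twist:
  assumes "\<And>i. Z i \<in> carrier_mat (block_dim m1 i) (block_dim m1 i)"
    and "\<And>i. i \<in> {1..p} \<Longrightarrow> Z i * Lam_block m1 m2 ev i = Lam_block m1 m2 (\<lambda>i. - cnj (ev i)) i * Z i"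
  shows "diag_block_mat (map Z [1..<Suc p]) * Lam_mat m1 m2 p ev =
    - (Lam_mat m1 m2 p ev)\<^sup>T * diag_block_mat (map Z [1..<Suc p])"
proof -
  have "diag_block_mat (map Z [1..<Suc p]) * diag_block_mat (map (Lam_block m1 m2 ev) [1..<Suc p]) =
      diag_block_mat (map (\<lambda>i. Z i * Lam_block m1 m2 ev i) [1..<Suc p])"
    by (rule mult_diag_block_mat[where d = "block_dim m1"]) (auto simp: assms(1) Lam_block_carrier)
  also have "map (\<lambda>i. Z i * Lam_block m1 m2 ev i) [1..<Suc p] =
      map (\<lambda>i. Lam_block m1 m2 (\<lambda>i. - cnj (ev i)) i * Z i) [1..<Suc p]"
    by (intro map_cong refl assms(2)) auto
  also have "diag_block_mat \<dots> = diag_block_mat (map (Lam_block m1 m2 (\<lambda>i. - cnj (ev i))) [1..<Suc p]) *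
      diag_block_mat (map Z [1..<Suc p])"
    by (rule mult_diag_block_mat[where d = "block_dim m1", symmetric])
      (auto simp: assms(1) Lam_block_carrier)
  finally show ?thesis by (simp only: Lam_mat_eq[symmetric] Lam_mat_neg_cnj)
qed

lemma Z1_mat_twist:
  assumes ev: "eigenvalue_kinds m1 m2 p ev"
  shows "Z1_mat m1 m2 p \<alpha> \<beta> * Lam_mat m1 m2 p ev = - (Lam_mat m1 m2 p ev)\<^sup>T * Z1_mat m1 m2 p \<alpha> \<beta>"
  unfolding Z1_mat_eq
proof (rule diag_block_mat_twist[OF Z1_block_carrier])
  fix i assume i: "i \<in> {1..p}"
  show "Z1_block m1 m2 \<alpha> \<beta> i * Lam_block m1 m2 ev i =
      Lam_block m1 m2 (\<lambda>i. - cnj (ev i)) i * Z1_block m1 m2 \<alpha> \<beta> i"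
  proof (cases "i \<le> m1")
    case True
    then show ?thesis
      unfolding Z1_block_def Lam_block_def by_kind_def
      by (simp add: J2_def Lam_hat_def mat2_one mat2_smult mat2_add mat2_transpose mat2_uminus
          mat2_mult mult.commute four_block_mat2_intertwine del: diag_block_mat.simps)
  next
    case False
    then show ?thesis
      using ev i
      by (auto simp: Z1_block_def Lam_block_def by_kind_def J2_def mat2_smult mat2_mult
          eigenvalue_kinds_def mult.commute)
  qed
qed

lemma Z2_mat_twist:
  assumes ev: "eigenvalue_kinds m1 m2 p ev"
  shows "Z2_mat m1 m2 p u v * Lam_mat m1 m2 p ev = - (Lam_mat m1 m2 p ev)\<^sup>T * Z2_mat m1 m2 p u v"
  unfolding Z2_mat_eq
proof (rule diag_block_mat_twist[OF Z2_block_carrier])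
  fix i assume i: "i \<in> {1..p}"
  show "Z2_block m1 m2 u v i * Lam_block m1 m2 ev i =
      Lam_block m1 m2 (\<lambda>i. - cnj (ev i)) i * Z2_block m1 m2 u v i"
  proof (cases "i \<le> m1")
    case True
    then show ?thesis
      unfolding Z2_block_def Lam_block_def by_kind_def
      by (simp add: J2_def Lam_hat_def mat2_one mat2_smult mat2_add mat2_minus mat2_transpose mat2_uminus
          mat2_mult mult.commute four_block_mat2_intertwine del: diag_block_mat.simps)
  next
    case False
    then show ?thesis
      using ev i
      by (auto simp: Z2_block_def Lam_block_def by_kind_def mat2_one mat2_smult mat2_mult
          eigenvalue_kinds_def mult.commute)
  qed
qed

section \<open>The structure of the update\<close>

lemma uminus_mat_eq_smult: "- A = (- 1 :: 'a::comm_ring_1) \<cdot>\<^sub>m A"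
  by (rule eq_matI) auto

lemma one_smult_mat [simp]: "(1 :: 'a::comm_ring_1) \<cdot>\<^sub>m A = A"
  by (rule eq_matI) auto

lemma intertwine_mult:
  fixes W :: "'a::semiring_0 mat"
  assumes "W \<in> carrier_mat n n" "Y1 \<in> carrier_mat n n" "Y2 \<in> carrier_mat n n"
    "Y1' \<in> carrier_mat n n" "Y2' \<in> carrier_mat n n"
    and "W * Y1 = Y1' * W" "W * Y2 = Y2' * W"
  shows "W * (Y1 * Y2) = (Y1' * Y2') * W"
proof -
  have "W * (Y1 * Y2) = (W * Y1) * Y2" using assms(1-5) by (simp add: mult_mat_assoc)
  also have "\<dots> = Y1' * (W * Y2)" unfolding assms(6) using assms(1-5) by (simp add: mult_mat_assoc)
  finally show ?thesis unfolding assms(7) using assms(1-5) by (simp add: mult_mat_assoc)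
qed

lemma commute_inverse:
  fixes W :: "'a::semiring_1 mat"
  assumes car: "W \<in> carrier_mat n n" "P \<in> carrier_mat n n" "H \<in> carrier_mat n n"
    and WP: "W * P = P * W" and PH: "P * H = 1\<^sub>m n" and HP: "H * P = 1\<^sub>m n"
  shows "W * H = H * W"
proof -
  have "W * H = (H * P) * (W * H)" unfolding HP using car by simp
  also have "\<dots> = H * ((P * W) * H)" using car by (simp add: mult_mat_assoc)
  also have "\<dots> = H * (W * (P * H))" unfolding WP[symmetric] using car by (simp add: mult_mat_assoc)
  finally show ?thesis unfolding PH using car by simp
qed

text \<open>All six summands of the two update matrices are of the form \<open>W Y\<close> with \<open>W\<close> symmetric or
  skew-symmetric; this rule reads off the symmetry of \<open>W Y\<close> from the matrix \<open>Y'\<close> that \<open>Y\<close> turns into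
  when it is moved across \<open>W\<close>.\<close>
lemma transpose_of_intertwined:
  fixes W :: "'a::comm_ring_1 mat"
  assumes car: "W \<in> carrier_mat n n" "Y \<in> carrier_mat n n" "Y' \<in> carrier_mat n n"
    and WY: "W * Y = Y' * W" and W: "W\<^sup>T = s \<cdot>\<^sub>m W" and Y: "Y'\<^sup>T = t \<cdot>\<^sub>m Y"
  shows "(W * Y)\<^sup>T = (s * t) \<cdot>\<^sub>m (W * Y)"
proof -
  have "(W * Y)\<^sup>T = W\<^sup>T * Y'\<^sup>T" unfolding WY using car by (simp add: transpose_mult_mat)
  also have "\<dots> = (s * t) \<cdot>\<^sub>m (W * Y)"
    unfolding W Y using car by (intro eq_matI) (auto simp: scalar_prod_def sum_distrib_left mult.assoc mult.left_commute)
  finally show ?thesis .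
qed

text \<open>Moving across any of \<open>G\<close>, \<open>Z\<^sub>1\<close>, \<open>Z\<^sub>2\<close> turns \<open>A\<close> into \<open>-A\<^sup>T\<close> and \<open>A\<^sup>T\<close> into \<open>-A\<close>; therefore
  \<open>A\<^sup>T A\<close>, and with it \<open>H = (A\<^sup>T A + I)\<^sup>-\<^sup>1\<close>, is left unchanged. The matrices \<open>A\<close>, \<open>A\<^sup>T\<close>, \<open>D\<close>, \<open>H\<close>
  commute with each other, and \<open>transpose_of_intertwined\<close> applies to each summand.\<close>
lemma update_structure:
  fixes A D H G Z\<^sub>1 Z\<^sub>2 :: "'a::comm_ring_1 mat"
  assumes car: "A \<in> carrier_mat n n" "D \<in> carrier_mat n n" "H \<in> carrier_mat n n"
    "G \<in> carrier_mat n n" "Z\<^sub>1 \<in> carrier_mat n n" "Z\<^sub>2 \<in> carrier_mat n n"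
    and AA: "A * A\<^sup>T = A\<^sup>T * A" and DA: "D * A = A * D" and DAT: "D * A\<^sup>T = A\<^sup>T * D"
    and PH: "(A\<^sup>T * A + 1\<^sub>m n) * H = 1\<^sub>m n" and HP: "H * (A\<^sup>T * A + 1\<^sub>m n) = 1\<^sub>m n"
    and G: "G\<^sup>T = - G" "G * D = - D\<^sup>T * G" "G * A = - A\<^sup>T * G" "G * A\<^sup>T = - A * G"
    and Z\<^sub>1: "Z\<^sub>1\<^sup>T = - Z\<^sub>1" "Z\<^sub>1 * A = - A\<^sup>T * Z\<^sub>1" "Z\<^sub>1 * A\<^sup>T = - A * Z\<^sub>1"
    and Z\<^sub>2: "Z\<^sub>2\<^sup>T = Z\<^sub>2" "Z\<^sub>2 * A = - A\<^sup>T * Z\<^sub>2" "Z\<^sub>2 * A\<^sup>T = - A * Z\<^sub>2"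
  shows "(G * D * H * A\<^sup>T + Z\<^sub>1 * (1\<^sub>m n - A * H * A\<^sup>T) - Z\<^sub>2 * H * A\<^sup>T)\<^sup>T =
      - (G * D * H * A\<^sup>T + Z\<^sub>1 * (1\<^sub>m n - A * H * A\<^sup>T) - Z\<^sub>2 * H * A\<^sup>T)"
    and "(G * D * H - Z\<^sub>1 * A * H + Z\<^sub>2 * (1\<^sub>m n - H))\<^sup>T = G * D * H - Z\<^sub>1 * A * H + Z\<^sub>2 * (1\<^sub>m n - H)"
proof -
  define P where "P = A\<^sup>T * A + 1\<^sub>m n"
  have P: "P \<in> carrier_mat n n" using car by (simp add: P_def)
  note cars = car P
  have PT: "P\<^sup>T = P" using car
    by (simp add: P_def transpose_add[of _ n n] transpose_mult_mat)
  have HT: "H\<^sup>T = H"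
  proof -
    have "H\<^sup>T * P = (P * H)\<^sup>T" using cars PT by (simp add: transpose_mult_mat)
    also have "\<dots> = 1\<^sub>m n" using PH by (simp add: P_def)
    finally have "H\<^sup>T * P * H = H" using cars by simp
    then have "H\<^sup>T * (P * H) = H" using cars by (simp add: mult_mat_assoc)
    then show ?thesis using PH car by (simp add: P_def)
  qed
  have H_commute: "W * H = H * W"
    if W: "W \<in> carrier_mat n n" and WP: "W * (A\<^sup>T * A) = (A\<^sup>T * A) * W" for W
  proof (rule commute_inverse[OF W P car(3)])
    show "W * P = P * W"
      using W car WP by (simp add: P_def mult_mat_add_distrib add_mat_mult_distrib)
  qed (use PH HP in \<open>simp_all add: P_def\<close>)
  have twist_H: "W * H = H * W"
    if W: "W \<in> carrier_mat n n" and WA: "W * A = - A\<^sup>T * W" and WAT: "W * A\<^sup>T = - A * W" for W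
  proof (rule H_commute[OF W])
    have "W * (A\<^sup>T * A) = (- A * - A\<^sup>T) * W"
      using W car WA WAT by (intro intertwine_mult) auto
    then show "W * (A\<^sup>T * A) = (A\<^sup>T * A) * W" by (simp add: AA)
  qed
  have AH: "A * H = H * A"
  proof (rule H_commute[OF car(1)])
    show "A * (A\<^sup>T * A) = A\<^sup>T * A * A"
      using car AA by (intro intertwine_mult) auto
  qed
  have ATH: "A\<^sup>T * H = H * A\<^sup>T"
    by (metis AH HT car(1,3) transpose_mult)
  have DH: "D * H = H * D"
  proof (rule H_commute[OF car(2)])
    show "D * (A\<^sup>T * A) = A\<^sup>T * A * D"
      using car DA DAT by (intro intertwine_mult) auto
  qed
  have GH: "G * H = H * G" and Z1H: "Z\<^sub>1 * H = H * Z\<^sub>1" and Z2H: "Z\<^sub>2 * H = H * Z\<^sub>2"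
    using twist_H car G Z\<^sub>1 Z\<^sub>2 by blast+
  have AHAT: "A * H * A\<^sup>T = A\<^sup>T * H * A"
  proof -
    have "A * H * A\<^sup>T = H * (A * A\<^sup>T)" unfolding AH using car by (simp add: mult_mat_assoc)
    also have "\<dots> = H * A\<^sup>T * A" unfolding AA using car by (simp add: mult_mat_assoc)
    finally show ?thesis unfolding ATH .
  qed

  have 1: "(G * (D * H * A\<^sup>T))\<^sup>T = (- 1 * 1) \<cdot>\<^sub>m (G * (D * H * A\<^sup>T))"
  proof (rule transpose_of_intertwined)
    show "G * (D * H * A\<^sup>T) = (- D\<^sup>T * H * - A) * G"
      using car G GH by (intro intertwine_mult mult_carrier_mat) auto
    have "(- D\<^sup>T * H * - A)\<^sup>T = A\<^sup>T * (H * D)"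
      using car HT by (simp add: transpose_mult_mat transpose_uminus mult_mat_assoc)
    also have "\<dots> = D * H * A\<^sup>T"
    proof -
      have "A\<^sup>T * (H * D) = (A\<^sup>T * D) * H" unfolding DH[symmetric] using car by (simp add: mult_mat_assoc)
      also have "\<dots> = D * (A\<^sup>T * H)" unfolding DAT[symmetric] using car by (simp add: mult_mat_assoc)
      also have "\<dots> = D * H * A\<^sup>T" unfolding ATH using car by (simp add: mult_mat_assoc)
      finally show ?thesis .
    qed
    finally show "(- D\<^sup>T * H * - A)\<^sup>T = 1 \<cdot>\<^sub>m (D * H * A\<^sup>T)" by simp
  qed (use car G(1) in \<open>auto simp: uminus_mat_eq_smult\<close>)
  have 2: "(Z\<^sub>1 * (1\<^sub>m n - A * H * A\<^sup>T))\<^sup>T = (- 1 * 1) \<cdot>\<^sub>m (Z\<^sub>1 * (1\<^sub>m n - A * H * A\<^sup>T))"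
  proof (rule transpose_of_intertwined)
    have "Z\<^sub>1 * (A * H * A\<^sup>T) = (- A\<^sup>T * H * - A) * Z\<^sub>1"
      using car Z\<^sub>1 Z1H by (intro intertwine_mult mult_carrier_mat) auto
    then have "Z\<^sub>1 * (A * H * A\<^sup>T) = (A * H * A\<^sup>T) * Z\<^sub>1" using car by (simp add: AHAT)
    then show "Z\<^sub>1 * (1\<^sub>m n - A * H * A\<^sup>T) = (1\<^sub>m n - A * H * A\<^sup>T) * Z\<^sub>1"
      using car by (simp add: mult_mat_minus_distrib minus_mat_mult_distrib)
    show "(1\<^sub>m n - A * H * A\<^sup>T)\<^sup>T = 1 \<cdot>\<^sub>m (1\<^sub>m n - A * H * A\<^sup>T)"
      using car HT by (simp add: transpose_minus[of _ n n] transpose_mult_mat mult_mat_assoc)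
  qed (use car Z\<^sub>1(1) in \<open>auto simp: uminus_mat_eq_smult\<close>)
  have 3: "(Z\<^sub>2 * (H * A\<^sup>T))\<^sup>T = (1 * - 1) \<cdot>\<^sub>m (Z\<^sub>2 * (H * A\<^sup>T))"
  proof (rule transpose_of_intertwined)
    show "Z\<^sub>2 * (H * A\<^sup>T) = (H * - A) * Z\<^sub>2"
      using car Z\<^sub>2 Z2H by (intro intertwine_mult mult_carrier_mat) auto
    show "(H * - A)\<^sup>T = - 1 \<cdot>\<^sub>m (H * A\<^sup>T)"
      using car HT by (simp add: transpose_mult_mat transpose_uminus ATH flip: uminus_mat_eq_smult)
  qed (use car Z\<^sub>2(1) in auto)
  have 4: "(G * (D * H))\<^sup>T = (- 1 * - 1) \<cdot>\<^sub>m (G * (D * H))"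
  proof (rule transpose_of_intertwined)
    show "G * (D * H) = (- D\<^sup>T * H) * G"
      using car G GH by (intro intertwine_mult mult_carrier_mat) auto
    show "(- D\<^sup>T * H)\<^sup>T = - 1 \<cdot>\<^sub>m (D * H)"
      using car HT by (simp add: transpose_mult_mat transpose_uminus DH flip: uminus_mat_eq_smult)
  qed (use car G(1) in \<open>auto simp: uminus_mat_eq_smult\<close>)
  have 5: "(Z\<^sub>1 * (A * H))\<^sup>T = (- 1 * - 1) \<cdot>\<^sub>m (Z\<^sub>1 * (A * H))"
  proof (rule transpose_of_intertwined)
    show "Z\<^sub>1 * (A * H) = (- A\<^sup>T * H) * Z\<^sub>1"
      using car Z\<^sub>1 Z1H by (intro intertwine_mult mult_carrier_mat) auto
    show "(- A\<^sup>T * H)\<^sup>T = - 1 \<cdot>\<^sub>m (A * H)"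
      using car HT by (simp add: transpose_mult_mat transpose_uminus AH flip: uminus_mat_eq_smult)
  qed (use car Z\<^sub>1(1) in \<open>auto simp: uminus_mat_eq_smult\<close>)
  have 6: "(Z\<^sub>2 * (1\<^sub>m n - H))\<^sup>T = (1 * 1) \<cdot>\<^sub>m (Z\<^sub>2 * (1\<^sub>m n - H))"
  proof (rule transpose_of_intertwined)
    show "Z\<^sub>2 * (1\<^sub>m n - H) = (1\<^sub>m n - H) * Z\<^sub>2"
      using car Z2H by (simp add: mult_mat_minus_distrib minus_mat_mult_distrib)
    show "(1\<^sub>m n - H)\<^sup>T = 1 \<cdot>\<^sub>m (1\<^sub>m n - H)"
      using car HT by (simp add: transpose_minus[of _ n n])
  qed (use car Z\<^sub>2(1) in auto)
  have E: "G * D * H * A\<^sup>T = G * (D * H * A\<^sup>T)" "Z\<^sub>2 * H * A\<^sup>T = Z\<^sub>2 * (H * A\<^sup>T)"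
    "G * D * H = G * (D * H)" "Z\<^sub>1 * A * H = Z\<^sub>1 * (A * H)"
    using car by (simp_all add: mult_mat_assoc)
  have c: "G * (D * H * A\<^sup>T) \<in> carrier_mat n n" "Z\<^sub>1 * (1\<^sub>m n - A * H * A\<^sup>T) \<in> carrier_mat n n"
    "Z\<^sub>2 * (H * A\<^sup>T) \<in> carrier_mat n n" "G * (D * H) \<in> carrier_mat n n" "Z\<^sub>1 * (A * H) \<in> carrier_mat n n"
    "Z\<^sub>2 * (1\<^sub>m n - H) \<in> carrier_mat n n"
    using car by (auto intro!: carrier_matI)
  have skew: "(X + Y - Z)\<^sup>T = - (X + Y - Z)"
    if "X \<in> carrier_mat n n" "Y \<in> carrier_mat n n" "Z \<in> carrier_mat n n"
      "X\<^sup>T = (- 1 * 1) \<cdot>\<^sub>m X" "Y\<^sup>T = (- 1 * 1) \<cdot>\<^sub>m Y" "Z\<^sup>T = (1 * - 1) \<cdot>\<^sub>m Z" for X Y Z :: "'a mat"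
  proof -
    have "(X + Y - Z)\<^sup>T = X\<^sup>T + Y\<^sup>T - Z\<^sup>T"
      using that(1-3) by (simp add: transpose_minus[of _ n n] transpose_add[of _ n n])
    then show ?thesis unfolding that(4-6) using that(1-3) by (simp; intro eq_matI; simp)
  qed
  have sym: "(X - Y + Z)\<^sup>T = X - Y + Z"
    if "X \<in> carrier_mat n n" "Y \<in> carrier_mat n n" "Z \<in> carrier_mat n n"
      "X\<^sup>T = (- 1 * - 1) \<cdot>\<^sub>m X" "Y\<^sup>T = (- 1 * - 1) \<cdot>\<^sub>m Y" "Z\<^sup>T = (1 * 1) \<cdot>\<^sub>m Z" for X Y Z :: "'a mat"
    using that by (simp add: transpose_minus[of _ n n] transpose_add[of _ n n] minus_carrier_mat)
  show "(G * D * H * A\<^sup>T + Z\<^sub>1 * (1\<^sub>m n - A * H * A\<^sup>T) - Z\<^sub>2 * H * A\<^sup>T)\<^sup>T =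
      - (G * D * H * A\<^sup>T + Z\<^sub>1 * (1\<^sub>m n - A * H * A\<^sup>T) - Z\<^sub>2 * H * A\<^sup>T)"
    unfolding E(1,2) by (rule skew[OF c(1,2,3) 1 2 3])
  show "(G * D * H - Z\<^sub>1 * A * H + Z\<^sub>2 * (1\<^sub>m n - H))\<^sup>T = G * D * H - Z\<^sub>1 * A * H + Z\<^sub>2 * (1\<^sub>m n - H)"
    unfolding E(3,4) by (rule sym[OF c(4,5,6) 4 5 6])
qed

text \<open>With \<open>Y = H A\<^sup>T A = I - H\<close> the terms in \<open>Z\<^sub>1\<close> and \<open>Z\<^sub>2\<close> cancel, and \<open>G D Y + G D H = G D\<close> remains.\<close>
lemma update_moves_spectrum:
  fixes A D H G Z\<^sub>1 Z\<^sub>2 :: "'a::comm_ring_1 mat"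
  assumes car: "A \<in> carrier_mat n n" "D \<in> carrier_mat n n" "H \<in> carrier_mat n n"
    "G \<in> carrier_mat n n" "Z\<^sub>1 \<in> carrier_mat n n" "Z\<^sub>2 \<in> carrier_mat n n"
    and HP: "H * (A\<^sup>T * A + 1\<^sub>m n) = 1\<^sub>m n"
  shows "(G * D * H * A\<^sup>T + Z\<^sub>1 * (1\<^sub>m n - A * H * A\<^sup>T) - Z\<^sub>2 * H * A\<^sup>T) * A +
    (G * D * H - Z\<^sub>1 * A * H + Z\<^sub>2 * (1\<^sub>m n - H)) = G * D"
proof -
  define Y where "Y = H * A\<^sup>T * A"
  have Y: "Y \<in> carrier_mat n n" using car by (simp add: Y_def)
  have "H * (A\<^sup>T * A + 1\<^sub>m n) = Y + H"
    using car by (simp add: Y_def mult_mat_add_distrib mult_mat_assoc)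
  then have "Y + H = 1\<^sub>m n" using HP by simp
  moreover have "H = (Y + H) - Y" using car Y by (intro eq_matI) auto
  ultimately have H: "H = 1\<^sub>m n - Y" by simp
  have "(G * D * H * A\<^sup>T + Z\<^sub>1 * (1\<^sub>m n - A * H * A\<^sup>T) - Z\<^sub>2 * H * A\<^sup>T) * A =
      G * D * Y + Z\<^sub>1 * (A - A * Y) - Z\<^sub>2 * Y"
    using car by (simp add: Y_def add_mat_mult_distrib minus_mat_mult_distrib mult_mat_minus_distrib mult_mat_assoc)
  moreover have "G * D * H - Z\<^sub>1 * A * H + Z\<^sub>2 * (1\<^sub>m n - H) = (G * D - G * D * Y) - Z\<^sub>1 * (A - A * Y) + Z\<^sub>2 * Y"
  proof -
    have "1\<^sub>m n - H = Y" unfolding H using Y by (intro eq_matI) auto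
    then have "Z\<^sub>2 * (1\<^sub>m n - H) = Z\<^sub>2 * Y" by simp
    moreover have "G * D * H = G * D - G * D * Y" "Z\<^sub>1 * A * H = Z\<^sub>1 * (A - A * Y)"
      unfolding H using car Y by (simp_all add: mult_mat_minus_distrib mult_mat_assoc)
    ultimately show ?thesis by simp
  qed
  moreover have "X\<^sub>1 + X\<^sub>2 - X\<^sub>3 + ((X\<^sub>4 - X\<^sub>1) - X\<^sub>2 + X\<^sub>3) = X\<^sub>4"
    if "X\<^sub>1 \<in> carrier_mat n n" "X\<^sub>2 \<in> carrier_mat n n" "X\<^sub>3 \<in> carrier_mat n n" "X\<^sub>4 \<in> carrier_mat n n"
    for X\<^sub>1 X\<^sub>2 X\<^sub>3 X\<^sub>4 :: "'a mat"
    using that by (intro eq_matI) auto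
  ultimately show ?thesis using car Y by (simp add: minus_carrier_mat)
qed

section \<open>Deflating pairs of structured pencils\<close>

lemma mat_eq_uminus_if_add_zero:
  fixes A :: "'a::group_add mat"
  assumes "A \<in> carrier_mat n m" "B \<in> carrier_mat n m" "A + B = 0\<^sub>m n m"
  shows "A = - B"
proof (rule eq_matI)
  fix i j assume "i < dim_row (- B)" "j < dim_col (- B)"
  then show "A $$ (i, j) = (- B) $$ (i, j)"
    using arg_cong[OF assms(3), of "\<lambda>C. C $$ (i, j)"] assms(1,2) by (simp add: eq_neg_iff_add_eq_0)
qed (use assms in auto)

lemma cmat_add:
  "A \<in> carrier_mat n m \<Longrightarrow> B \<in> carrier_mat n m \<Longrightarrow> cmat (A + B) = cmat A + cmat B"
  by (intro eq_matI) auto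

lemma cmat_uminus: "cmat (- A) = - cmat A"
  by (intro eq_matI) auto

lemma cmat_zero: "cmat (0\<^sub>m n m) = 0\<^sub>m n m"
  by (intro eq_matI) auto

lemma cmat_deflating_residual:
  assumes "M \<in> carrier_mat N N" "K \<in> carrier_mat N N" "X \<in> carrier_mat N q" "L \<in> carrier_mat q q"
  shows "cmat (M * X * L + K * X) = cmat M * cmat X * cmat L + cmat K * cmat X"
  using assms
  by (simp add: of_real_hom.mat_hom_mult[of _ N N _ q] of_real_hom.mat_hom_mult[of _ N q _ q]
      of_real_hom.mat_hom_mult[of _ q q _ q] cmat_add[of _ N q] mult_mat_assoc)

lemma gram_skew:
  fixes S :: "'a::comm_ring_1 mat"
  assumes "S \<in> carrier_mat N N" "X \<in> carrier_mat N q" "S\<^sup>T = - S"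
  shows "(X\<^sup>T * S * X)\<^sup>T = - (X\<^sup>T * S * X)"
  using assms by (simp add: transpose_mult_mat mult_mat_assoc)

text \<open>The matrix \<open>G L\<close>, with \<open>G = X\<^sup>T S X\<close>, equals \<open>-X\<^sup>T R X\<close> and is symmetric, whereas \<open>G\<close> is
  skew-symmetric.\<close>
lemma gram_twist:
  fixes S R :: "'a::comm_ring_1 mat"
  assumes car: "S \<in> carrier_mat N N" "R \<in> carrier_mat N N" "X \<in> carrier_mat N q" "L \<in> carrier_mat q q"
    and S: "S\<^sup>T = - S" and R: "R\<^sup>T = R" and defl: "S * X * L = - (R * X)"
  shows "(X\<^sup>T * S * X) * L = - L\<^sup>T * (X\<^sup>T * S * X)"
proof -
  let ?G = "X\<^sup>T * S * X"
  have "?G * L = X\<^sup>T * (S * X * L)" using car by (simp add: mult_mat_assoc)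
  also have "\<dots> = - (X\<^sup>T * R * X)" unfolding defl using car by (simp add: mult_mat_assoc)
  finally have GL: "?G * L = - (X\<^sup>T * R * X)" .
  have "(X\<^sup>T * R * X)\<^sup>T = X\<^sup>T * R * X"
    using car R by (simp add: transpose_mult_mat mult_mat_assoc)
  then have "?G * L = (?G * L)\<^sup>T" unfolding GL by (simp add: transpose_uminus)
  also have "\<dots> = L\<^sup>T * ?G\<^sup>T" using car by (simp add: transpose_mult_mat)
  finally show ?thesis unfolding gram_skew[OF car(1,3) S] using car by simp
qed

text \<open>With \<open>W = Y\<^sup>T S X\<close>, both \<open>W L\<close> and \<open>-L'\<^sup>T W\<close> are equal to \<open>-Y\<^sup>T R X\<close>. This is a homogeneous
  Sylvester equation with disjoint spectra.\<close>
lemma deflating_orthogonality: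
  fixes S R X L Y L' :: "complex mat"
  assumes car: "S \<in> carrier_mat N N" "R \<in> carrier_mat N N" "X \<in> carrier_mat N q" "L \<in> carrier_mat q q"
    "Y \<in> carrier_mat N r" "L' \<in> carrier_mat r r"
    and S: "S\<^sup>T = - S" and R: "R\<^sup>T = R"
    and X: "S * X * L = - (R * X)" and Y: "S * Y * L' = - (R * Y)"
    and disj: "spectrum L \<inter> spectrum (- L'\<^sup>T) = {}"
  shows "X\<^sup>T * S * Y = 0\<^sub>m q r"
proof -
  let ?W = "Y\<^sup>T * S * X"
  have "- L'\<^sup>T * ?W = (S * Y * L')\<^sup>T * X"
    using car S by (simp add: transpose_mult_mat mult_mat_assoc)
  also have "\<dots> = - (Y\<^sup>T * R * X)"
    unfolding Y using car R by (simp add: transpose_uminus transpose_mult_mat)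
  also have "\<dots> = Y\<^sup>T * (S * X * L)" unfolding X using car by (simp add: mult_mat_assoc)
  also have "\<dots> = ?W * L" using car by (simp add: mult_mat_assoc)
  finally have "?W = 0\<^sub>m r q"
    using car disj by (intro sylvester_trivial[of "- L'\<^sup>T" r L q]) auto
  moreover have "X\<^sup>T * S * Y = - ?W\<^sup>T"
    using car S by (simp add: transpose_mult_mat mult_mat_assoc)
  ultimately show ?thesis by (auto intro: eq_matI)
qed

section \<open>The update of the pencil\<close>

theorem mainTheorem15:
  fixes M K X\<^sub>c \<Lambda>\<^sub>c \<Lambda>\<^sub>a G U H\<^sub>a Z\<^sub>1 Z\<^sub>2 M_hat K_hat \<Delta>M \<Delta>K :: "real mat"
    and X\<^sub>f \<Lambda>\<^sub>f :: "complex mat"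
    and n m\<^sub>1 m\<^sub>2 p :: nat
    and ev\<^sub>c ev\<^sub>a :: "nat \<Rightarrow> complex"
    and x xh :: "nat \<Rightarrow> complex vec"
    and \<alpha> \<beta> u v :: "nat \<Rightarrow> real"
  assumes "T_SHH n M K" and "regular_pencil M K"
    and "m\<^sub>1 \<le> m\<^sub>2" and "m\<^sub>2 \<le> p" and "2 * m\<^sub>1 + 2 * p < 2 * n"
    and "eigenvalue_kinds m\<^sub>1 m\<^sub>2 p ev\<^sub>c" and "eigenvalue_kinds m\<^sub>1 m\<^sub>2 p ev\<^sub>a"
    and "eigen_data (2 * n) M K m\<^sub>1 m\<^sub>2 p ev\<^sub>c x xh"
    and "X\<^sub>c = X_mat (2 * n) m\<^sub>1 m\<^sub>2 p x xh"
    and "\<Lambda>\<^sub>c = Lam_mat m\<^sub>1 m\<^sub>2 p ev\<^sub>c" and "\<Lambda>\<^sub>a = Lam_mat m\<^sub>1 m\<^sub>2 p ev\<^sub>a"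
    and "complementary_deflating_pairs (2 * n) (cmat M) (cmat K) (cmat X\<^sub>c, cmat \<Lambda>\<^sub>c) (X\<^sub>f, \<Lambda>\<^sub>f)"
    and "spectrum (cmat \<Lambda>\<^sub>c) \<inter> spectrum (- \<Lambda>\<^sub>f\<^sup>T) = {}"
    and "G = X\<^sub>c\<^sup>T * J_mat n * M * X\<^sub>c" and "invertible_mat G"
    and "distinct (changed_eigenvalues m\<^sub>1 m\<^sub>2 p ev\<^sub>c)"
    and "U = J_mat n * M * X\<^sub>c * inv_mat G"
    and "H\<^sub>a = inv_mat (\<Lambda>\<^sub>a\<^sup>T * \<Lambda>\<^sub>a + 1\<^sub>m (2 * m\<^sub>1 + 2 * p))"
    and "Z\<^sub>1 = Z1_mat m\<^sub>1 m\<^sub>2 p \<alpha> \<beta>" and "Z\<^sub>2 = Z2_mat m\<^sub>1 m\<^sub>2 p u v"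
    and "M_hat = G * (\<Lambda>\<^sub>c - \<Lambda>\<^sub>a) * H\<^sub>a * \<Lambda>\<^sub>a\<^sup>T
           + Z\<^sub>1 * (1\<^sub>m (2 * m\<^sub>1 + 2 * p) - \<Lambda>\<^sub>a * H\<^sub>a * \<Lambda>\<^sub>a\<^sup>T) - Z\<^sub>2 * H\<^sub>a * \<Lambda>\<^sub>a\<^sup>T"
    and "K_hat = G * (\<Lambda>\<^sub>c - \<Lambda>\<^sub>a) * H\<^sub>a - Z\<^sub>1 * \<Lambda>\<^sub>a * H\<^sub>a
           + Z\<^sub>2 * (1\<^sub>m (2 * m\<^sub>1 + 2 * p) - H\<^sub>a)"
    and "\<Delta>M = (J_mat n)\<^sup>T * U * M_hat * U\<^sup>T"
    and "\<Delta>K = (J_mat n)\<^sup>T * U * K_hat * U\<^sup>T"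
  shows "T_skew_Hamiltonian n \<Delta>M \<and> T_Hamiltonian n \<Delta>K \<and>
         complementary_deflating_pairs (2 * n) (cmat (M + \<Delta>M)) (cmat (K + \<Delta>K))
           (cmat X\<^sub>c, cmat \<Lambda>\<^sub>a) (X\<^sub>f, \<Lambda>\<^sub>f)"
proof -
  let ?N = "2 * n" and ?q = "2 * m\<^sub>1 + 2 * p" and ?J = "J_mat n :: real mat"
  note X\<^sub>c_def = assms(9) and \<Lambda>\<^sub>c_def = assms(10) and \<Lambda>\<^sub>a_def = assms(11) and compl = assms(12)
    and disj = assms(13) and G_def = assms(14) and G_inv = assms(15) and dist = assms(16)
    and U_def = assms(17) and H_def = assms(18) and Z\<^sub>1_def = assms(19) and Z\<^sub>2_def = assms(20)
    and Mh_def = assms(21) and Kh_def = assms(22) and dM_def = assms(23) and dK_def = assms(24)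
  have m1p: "m\<^sub>1 \<le> p" using assms(3,4) by simp
  note kc = assms(6) and ka = assms(7)
  have L: "\<Lambda>\<^sub>c \<in> carrier_mat ?q ?q" "\<Lambda>\<^sub>a \<in> carrier_mat ?q ?q"
    unfolding \<Lambda>\<^sub>c_def \<Lambda>\<^sub>a_def by (rule Lam_mat_carrier[OF m1p])+
  have Z: "Z\<^sub>1 \<in> carrier_mat ?q ?q" "Z\<^sub>2 \<in> carrier_mat ?q ?q"
    unfolding Z\<^sub>1_def Z\<^sub>2_def by (rule Z1_mat_carrier[OF m1p] Z2_mat_carrier[OF m1p])+
  have M: "M \<in> carrier_mat ?N ?N" and K: "K \<in> carrier_mat ?N ?N"
    and S_skew: "(?J * M)\<^sup>T = - (?J * M)" and R_sym: "(?J * K)\<^sup>T = ?J * K"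
    using assms(1) by (auto simp: T_SHH_def T_skew_Hamiltonian_def T_Hamiltonian_def)
  define S where "S = ?J * M"
  define R where "R = ?J * K"
  have S: "S \<in> carrier_mat ?N ?N" and R: "R \<in> carrier_mat ?N ?N"
    using M K by (auto simp: S_def R_def intro!: mult_carrier_mat[OF J_mat_carrier])
  have S_skew: "S\<^sup>T = - S" and R_sym: "R\<^sup>T = R" using S_skew R_sym by (simp_all add: S_def R_def)
  have JTS: "?J\<^sup>T * S = M" and JTR: "?J\<^sup>T * R = K"
  proof -
    have "?J\<^sup>T * S = (?J\<^sup>T * ?J) * M" "?J\<^sup>T * R = (?J\<^sup>T * ?J) * K"
      unfolding S_def R_def using M K by (simp_all add: mult_mat_assoc)
    then show "?J\<^sup>T * S = M" "?J\<^sup>T * R = K" unfolding J_mat_orthogonal using M K by simp_all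
  qed

  have "deflating_pair ?N (cmat M) (cmat K) (cmat X\<^sub>c, cmat \<Lambda>\<^sub>c)"
    and "deflating_pair ?N (cmat M) (cmat K) (X\<^sub>f, \<Lambda>\<^sub>f)"
    and nonsing: "invertible_mat (mat_of_cols ?N (cols (cmat X\<^sub>c) @ cols X\<^sub>f))"
    using compl by (simp_all add: complementary_deflating_pairs_def)
  then obtain q' r where q': "q' \<le> ?N" "cmat X\<^sub>c \<in> carrier_mat ?N q'" "cmat \<Lambda>\<^sub>c \<in> carrier_mat q' q'"
      "vec_space.rank ?N (cmat X\<^sub>c) = q'"
      "cmat M * cmat X\<^sub>c * cmat \<Lambda>\<^sub>c + cmat K * cmat X\<^sub>c = 0\<^sub>m ?N q'"
    and r: "r \<le> ?N" "X\<^sub>f \<in> carrier_mat ?N r" "\<Lambda>\<^sub>f \<in> carrier_mat r r" "vec_space.rank ?N X\<^sub>f = r"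
      "cmat M * X\<^sub>f * \<Lambda>\<^sub>f + cmat K * X\<^sub>f = 0\<^sub>m ?N r"
    unfolding deflating_pair_def by blast
  have "q' = ?q" using q'(3) L(1) by auto
  note q' = q'[unfolded this]
  have X: "X\<^sub>c \<in> carrier_mat ?N ?q" using q'(2) by auto
  have defl_c: "S * X\<^sub>c * \<Lambda>\<^sub>c = - (R * X\<^sub>c)"
  proof -
    have "cmat (M * X\<^sub>c * \<Lambda>\<^sub>c + K * X\<^sub>c) = cmat (0\<^sub>m ?N ?q)"
      unfolding cmat_deflating_residual[OF M K X L(1)] cmat_zero by (rule q'(5))
    then have "M * X\<^sub>c * \<Lambda>\<^sub>c + K * X\<^sub>c = 0\<^sub>m ?N ?q" by (rule of_real_hom.mat_hom_inj)
    then have "?J * (M * X\<^sub>c * \<Lambda>\<^sub>c + K * X\<^sub>c) = 0\<^sub>m ?N ?q" by simp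
    then have "S * X\<^sub>c * \<Lambda>\<^sub>c + R * X\<^sub>c = 0\<^sub>m ?N ?q"
      unfolding S_def R_def using M K X L by (simp add: mult_mat_add_distrib mult_mat_assoc)
    then show ?thesis using S R X L by (intro mat_eq_uminus_if_add_zero[of _ ?N ?q]) auto
  qed

  have G_eq: "G = X\<^sub>c\<^sup>T * S * X\<^sub>c" unfolding G_def S_def using M X by (simp add: mult_mat_assoc)
  have G: "G \<in> carrier_mat ?q ?q" unfolding G_eq using S X by auto
  have G_skew: "G\<^sup>T = - G" unfolding G_eq by (rule gram_skew[OF S X S_skew])
  have G_twist_c: "G * \<Lambda>\<^sub>c = - \<Lambda>\<^sub>c\<^sup>T * G"
    unfolding G_eq by (rule gram_twist[OF S R X L(1) S_skew R_sym defl_c])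
  note transfer = Lam_mat_twist_transfer[OF dist m1p kc _ G G_twist_c[unfolded \<Lambda>\<^sub>c_def]]
  \<comment> \<open>The transpose of \<open>\<Lambda>\<^sub>a\<close> is the eigenvalue matrix of the conjugate aims, so it is covered too.\<close>
  have G_twist_a: "G * \<Lambda>\<^sub>a = - \<Lambda>\<^sub>a\<^sup>T * G" "G * \<Lambda>\<^sub>a\<^sup>T = - \<Lambda>\<^sub>a * G"
    using transfer[OF ka] transfer[OF eigenvalue_kinds_cnj[OF ka]] by (simp_all add: \<Lambda>\<^sub>a_def Lam_mat_cnj)
  define Gi where "Gi = inv_mat G"
  have Gi: "Gi \<in> carrier_mat ?q ?q" "G * Gi = 1\<^sub>m ?q" "Gi * G = 1\<^sub>m ?q"
    unfolding Gi_def by (rule inv_mat_inverse[OF G G_inv])+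
  have U_eq: "U = S * X\<^sub>c * Gi" unfolding U_def S_def Gi_def ..
  have U: "U \<in> carrier_mat ?N ?q" unfolding U_eq using S X Gi by auto
  have UG: "U * G = S * X\<^sub>c" unfolding U_eq using S X Gi G by (simp add: mult_mat_assoc)
  have UT: "U\<^sup>T = Gi\<^sup>T * - (X\<^sub>c\<^sup>T * S)"
    unfolding U_eq using S X Gi S_skew by (simp add: transpose_mult_mat)
  \<comment> \<open>\<open>U\<^sup>T\<close> is a left inverse of \<open>X\<^sub>c\<close>; below it is seen to annihilate \<open>X\<^sub>f\<close>.\<close>
  have UTX: "U\<^sup>T * X\<^sub>c = 1\<^sub>m ?q"
  proof -
    have "U\<^sup>T * X\<^sub>c = Gi\<^sup>T * - G" unfolding UT G_eq using S X Gi by (simp add: mult_mat_assoc)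
    also have "\<dots> = (G * Gi)\<^sup>T" using G Gi(1) G_skew by (simp add: transpose_mult_mat)
    finally show ?thesis by (simp add: Gi)
  qed

  define D where "D = \<Lambda>\<^sub>c - \<Lambda>\<^sub>a"
  have D: "D \<in> carrier_mat ?q ?q" unfolding D_def using L by (simp add: minus_carrier_mat)
  have Hinv: "H\<^sub>a \<in> carrier_mat ?q ?q" "(\<Lambda>\<^sub>a\<^sup>T * \<Lambda>\<^sub>a + 1\<^sub>m ?q) * H\<^sub>a = 1\<^sub>m ?q"
    "H\<^sub>a * (\<Lambda>\<^sub>a\<^sup>T * \<Lambda>\<^sub>a + 1\<^sub>m ?q) = 1\<^sub>m ?q"
    unfolding H_def using L
    by (intro inv_mat_inverse invertible_transpose_mult_self_plus_one; simp)+
  note comm = Lam_mat_commute[OF dist m1p kc]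
  note kaT = eigenvalue_kinds_cnj[OF ka]
  have AA: "\<Lambda>\<^sub>a * \<Lambda>\<^sub>a\<^sup>T = \<Lambda>\<^sub>a\<^sup>T * \<Lambda>\<^sub>a"
    using comm[OF ka kaT] by (simp add: \<Lambda>\<^sub>a_def Lam_mat_cnj)
  have DA: "D * \<Lambda>\<^sub>a = \<Lambda>\<^sub>a * D"
    using comm[OF kc ka] L
    by (simp add: D_def \<Lambda>\<^sub>c_def[symmetric] \<Lambda>\<^sub>a_def[symmetric] mult_mat_minus_distrib minus_mat_mult_distrib)
  have DAT: "D * \<Lambda>\<^sub>a\<^sup>T = \<Lambda>\<^sub>a\<^sup>T * D"
    using comm[OF kc kaT] AA L
    by (simp add: D_def \<Lambda>\<^sub>c_def[symmetric] \<Lambda>\<^sub>a_def[symmetric] Lam_mat_cnj mult_mat_minus_distrib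
        minus_mat_mult_distrib)
  have G_twist_D: "G * D = - D\<^sup>T * G"
  proof -
    have "G * D = - (\<Lambda>\<^sub>c\<^sup>T * G) - - (\<Lambda>\<^sub>a\<^sup>T * G)"
      unfolding D_def using G L G_twist_c G_twist_a(1) by (simp add: mult_mat_minus_distrib)
    also have "\<dots> = - (\<Lambda>\<^sub>c\<^sup>T * G - \<Lambda>\<^sub>a\<^sup>T * G)"
      using G L by (intro eq_matI) auto
    also have "\<dots> = - D\<^sup>T * G"
      unfolding D_def using G L by (simp add: transpose_minus[of _ ?q ?q] minus_mat_mult_distrib)
    finally show ?thesis .
  qed
  have Z\<^sub>1_twist: "Z\<^sub>1 * \<Lambda>\<^sub>a = - \<Lambda>\<^sub>a\<^sup>T * Z\<^sub>1" "Z\<^sub>1 * \<Lambda>\<^sub>a\<^sup>T = - \<Lambda>\<^sub>a * Z\<^sub>1"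
    using Z1_mat_twist[OF ka] Z1_mat_twist[OF kaT] by (simp_all add: Z\<^sub>1_def \<Lambda>\<^sub>a_def Lam_mat_cnj)
  have Z\<^sub>2_twist: "Z\<^sub>2 * \<Lambda>\<^sub>a = - \<Lambda>\<^sub>a\<^sup>T * Z\<^sub>2" "Z\<^sub>2 * \<Lambda>\<^sub>a\<^sup>T = - \<Lambda>\<^sub>a * Z\<^sub>2"
    using Z2_mat_twist[OF ka] Z2_mat_twist[OF kaT] by (simp_all add: Z\<^sub>2_def \<Lambda>\<^sub>a_def Lam_mat_cnj)
  have Z\<^sub>1_skew: "Z\<^sub>1\<^sup>T = - Z\<^sub>1" and Z\<^sub>2_sym: "Z\<^sub>2\<^sup>T = Z\<^sub>2"
    unfolding Z\<^sub>1_def Z\<^sub>2_def by (rule Z1_mat_skew Z2_mat_symmetric)+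
  note cars = L(2) D Hinv(1) G Z
  have Mh_skew: "M_hat\<^sup>T = - M_hat" and Kh_sym: "K_hat\<^sup>T = K_hat"
    unfolding Mh_def Kh_def D_def[symmetric]
    by (rule update_structure[OF cars AA DA DAT Hinv(2,3) G_skew G_twist_D G_twist_a Z\<^sub>1_skew Z\<^sub>1_twist
          Z\<^sub>2_sym Z\<^sub>2_twist])+
  have MK: "M_hat * \<Lambda>\<^sub>a + K_hat = G * D"
    unfolding Mh_def Kh_def D_def[symmetric] by (rule update_moves_spectrum[OF cars Hinv(3)])
  have Mh: "M_hat \<in> carrier_mat ?q ?q"
    unfolding Mh_def using L Hinv(1) G Z by (intro carrier_matI) auto
  have Kh: "K_hat \<in> carrier_mat ?q ?q"
    unfolding Kh_def using L Hinv(1) G Z by (intro carrier_matI) auto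

  \<comment> \<open>Multiplication by \<open>J\<close> turns the pencil into a skew-symmetric/symmetric one, updated by \<open>V\<close> and \<open>W\<close>.\<close>
  define V where "V = U * M_hat * U\<^sup>T"
  define W where "W = U * K_hat * U\<^sup>T"
  have V: "V \<in> carrier_mat ?N ?N" and W: "W \<in> carrier_mat ?N ?N"
    unfolding V_def W_def using U Mh Kh by auto
  have dM: "\<Delta>M = ?J\<^sup>T * V" and dK: "\<Delta>K = ?J\<^sup>T * W"
    unfolding dM_def dK_def V_def W_def using U Mh Kh by (simp_all add: mult_mat_assoc)
  have dMc: "\<Delta>M \<in> carrier_mat ?N ?N" and dKc: "\<Delta>K \<in> carrier_mat ?N ?N"
    unfolding dM dK using V W by (auto intro!: carrier_matI)
  have JdM: "?J * \<Delta>M = V" and JdK: "?J * \<Delta>K = W"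
  proof -
    have "?J * \<Delta>M = (?J * ?J\<^sup>T) * V" "?J * \<Delta>K = (?J * ?J\<^sup>T) * W"
      unfolding dM dK using V W by (simp_all add: mult_mat_assoc)
    then show "?J * \<Delta>M = V" "?J * \<Delta>K = W" unfolding J_mat_orthogonal using V W by simp_all
  qed
  have V_skew: "V\<^sup>T = - V" unfolding V_def using U Mh Mh_skew
    by (simp add: transpose_mult_mat mult_mat_assoc)
  have W_sym: "W\<^sup>T = W" unfolding W_def using U Kh Kh_sym
    by (simp add: transpose_mult_mat mult_mat_assoc)
  have skewH: "T_skew_Hamiltonian n \<Delta>M" and Ham: "T_Hamiltonian n \<Delta>K"
    using dMc dKc V_skew W_sym by (simp_all add: T_skew_Hamiltonian_def T_Hamiltonian_def JdM JdK)

  have eq_c: "(M + \<Delta>M) * X\<^sub>c * \<Lambda>\<^sub>a + (K + \<Delta>K) * X\<^sub>c = 0\<^sub>m ?N ?q"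
  proof -
    have VX: "V * X\<^sub>c = U * M_hat"
      unfolding V_def using U Mh X by (simp add: mult_mat_assoc UTX)
    have WX: "W * X\<^sub>c = U * K_hat"
      unfolding W_def using U Kh X by (simp add: mult_mat_assoc UTX)
    have "V * X\<^sub>c * \<Lambda>\<^sub>a + W * X\<^sub>c = U * (M_hat * \<Lambda>\<^sub>a + K_hat)"
      unfolding VX WX using U Mh Kh L by (simp add: mult_mat_assoc mult_mat_add_distrib)
    also have "\<dots> = (U * G) * D" unfolding MK using U G D by (simp add: mult_mat_assoc)
    also have "\<dots> = S * X\<^sub>c * \<Lambda>\<^sub>c - S * X\<^sub>c * \<Lambda>\<^sub>a"
      unfolding UG D_def using S X L by (simp add: mult_mat_minus_distrib mult_mat_assoc)
    finally have VW: "V * X\<^sub>c * \<Lambda>\<^sub>a + W * X\<^sub>c = - (R * X\<^sub>c) - S * X\<^sub>c * \<Lambda>\<^sub>a" unfolding defl_c .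
    have "(S * X\<^sub>c * \<Lambda>\<^sub>a + R * X\<^sub>c) + (V * X\<^sub>c * \<Lambda>\<^sub>a + W * X\<^sub>c) = 0\<^sub>m ?N ?q"
      unfolding VW using S R X L by (intro eq_matI) auto
    moreover have "(M + \<Delta>M) * X\<^sub>c * \<Lambda>\<^sub>a + (K + \<Delta>K) * X\<^sub>c =
        ?J\<^sup>T * ((S * X\<^sub>c * \<Lambda>\<^sub>a + R * X\<^sub>c) + (V * X\<^sub>c * \<Lambda>\<^sub>a + W * X\<^sub>c))"
    proof -
      have "(M + \<Delta>M) * X\<^sub>c * \<Lambda>\<^sub>a + (K + \<Delta>K) * X\<^sub>c =
          (?J\<^sup>T * (S * X\<^sub>c * \<Lambda>\<^sub>a) + ?J\<^sup>T * (V * X\<^sub>c * \<Lambda>\<^sub>a)) + (?J\<^sup>T * (R * X\<^sub>c) + ?J\<^sup>T * (W * X\<^sub>c))"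
        unfolding JTS[symmetric] JTR[symmetric] dM dK using S R V W X L
        by (simp add: add_mat_mult_distrib mult_mat_assoc)
      also have "\<dots> = (?J\<^sup>T * (S * X\<^sub>c * \<Lambda>\<^sub>a) + ?J\<^sup>T * (R * X\<^sub>c)) +
          (?J\<^sup>T * (V * X\<^sub>c * \<Lambda>\<^sub>a) + ?J\<^sup>T * (W * X\<^sub>c))"
        using S R V W X L by (intro eq_matI) (auto simp del: index_mult_mat(1))
      also have "\<dots> = ?J\<^sup>T * ((S * X\<^sub>c * \<Lambda>\<^sub>a + R * X\<^sub>c) + (V * X\<^sub>c * \<Lambda>\<^sub>a + W * X\<^sub>c))"
        using S R V W X L by (simp add: mult_mat_add_distrib)
      finally show ?thesis .
    qed
    ultimately show ?thesis by simp
  qed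
  have defl_a: "deflating_pair ?N (cmat (M + \<Delta>M)) (cmat (K + \<Delta>K)) (cmat X\<^sub>c, cmat \<Lambda>\<^sub>a)"
  proof -
    have "cmat ((M + \<Delta>M) * X\<^sub>c * \<Lambda>\<^sub>a + (K + \<Delta>K) * X\<^sub>c) = cmat (0\<^sub>m ?N ?q)" unfolding eq_c ..
    then have "cmat (M + \<Delta>M) * cmat X\<^sub>c * cmat \<Lambda>\<^sub>a + cmat (K + \<Delta>K) * cmat X\<^sub>c = 0\<^sub>m ?N ?q"
      using cmat_deflating_residual[of "M + \<Delta>M" ?N "K + \<Delta>K" X\<^sub>c ?q \<Lambda>\<^sub>a] M K dMc dKc X L(2)
      by (simp only: add_carrier_mat cmat_zero)
    then show ?thesis unfolding deflating_pair_def using q'(1,2,4) L(2) by auto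
  qed

  have defl_f: "deflating_pair ?N (cmat (M + \<Delta>M)) (cmat (K + \<Delta>K)) (X\<^sub>f, \<Lambda>\<^sub>f)"
  proof -
    have cS: "cmat S = J_mat n * cmat M" and cR: "cmat R = J_mat n * cmat K"
    proof -
      have "cmat ?J = J_mat n" unfolding J_mat_def by (intro eq_matI) auto
      then show "cmat S = J_mat n * cmat M" "cmat R = J_mat n * cmat K"
        unfolding S_def R_def using M K by (simp_all add: of_real_hom.mat_hom_mult[of _ ?N ?N _ ?N])
    qed
    have "J_mat n * (cmat M * X\<^sub>f * \<Lambda>\<^sub>f + cmat K * X\<^sub>f) = 0\<^sub>m ?N r" unfolding r(5) by simp
    then have "cmat S * X\<^sub>f * \<Lambda>\<^sub>f + cmat R * X\<^sub>f = 0\<^sub>m ?N r"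
      unfolding cS cR using M K r(2,3) by (simp add: mult_mat_add_distrib mult_mat_assoc)
    then have f: "cmat S * X\<^sub>f * \<Lambda>\<^sub>f = - (cmat R * X\<^sub>f)"
      using S R r(2,3) by (intro mat_eq_uminus_if_add_zero[of _ ?N r]) auto
    have "cmat (S * X\<^sub>c * \<Lambda>\<^sub>c) = cmat (- (R * X\<^sub>c))" unfolding defl_c ..
    then have c: "cmat S * cmat X\<^sub>c * cmat \<Lambda>\<^sub>c = - (cmat R * cmat X\<^sub>c)"
      using S R X L
      by (simp add: of_real_hom.mat_hom_mult[of _ ?N ?N _ ?q] of_real_hom.mat_hom_mult[of _ ?N ?q _ ?q]
          cmat_uminus)
    have "(cmat S)\<^sup>T = - cmat S" "(cmat R)\<^sup>T = cmat R"
      using S_skew R_sym by (simp_all add: map_mat_transpose cmat_uminus)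
    then have orth: "(cmat X\<^sub>c)\<^sup>T * cmat S * X\<^sub>f = 0\<^sub>m ?q r"
      using S R X L r(2,3) c f disj
      by (intro deflating_orthogonality[where R = "cmat R" and L = "cmat \<Lambda>\<^sub>c" and L' = "\<Lambda>\<^sub>f" and N = ?N]) auto
    have "cmat (U\<^sup>T) * X\<^sub>f = - (cmat (Gi\<^sup>T) * ((cmat X\<^sub>c)\<^sup>T * cmat S * X\<^sub>f))"
      unfolding UT using S X Gi(1) r(2)
      by (simp add: of_real_hom.mat_hom_mult[of _ ?q ?q _ ?N] of_real_hom.mat_hom_mult[of _ ?q ?N _ ?N]
          cmat_uminus map_mat_transpose mult_mat_assoc)
    then have UTf: "cmat (U\<^sup>T) * X\<^sub>f = 0\<^sub>m ?q r"
      unfolding orth using Gi(1) by (auto intro: eq_matI)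
    have "cmat \<Delta>M = cmat (?J\<^sup>T * U * M_hat) * cmat (U\<^sup>T)" "cmat \<Delta>K = cmat (?J\<^sup>T * U * K_hat) * cmat (U\<^sup>T)"
      unfolding dM_def dK_def using U Mh Kh
      by (intro of_real_hom.mat_hom_mult[of _ ?N ?q _ ?N]; auto intro!: carrier_matI)+
    then have dXf: "cmat \<Delta>M * X\<^sub>f = 0\<^sub>m ?N r" "cmat \<Delta>K * X\<^sub>f = 0\<^sub>m ?N r"
      using U Mh Kh r(2) by (simp_all add: mult_mat_assoc UTf)
    have "cmat (M + \<Delta>M) * X\<^sub>f = cmat M * X\<^sub>f" "cmat (K + \<Delta>K) * X\<^sub>f = cmat K * X\<^sub>f"
      using M K dMc dKc r(2) dXf
      by (simp_all add: cmat_add[of _ ?N ?N] add_mat_mult_distrib)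
    then show ?thesis unfolding deflating_pair_def using r by auto
  qed
  show ?thesis
    using skewH Ham defl_a defl_f nonsing by (simp add: complementary_deflating_pairs_def)
qed

end
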